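(* Let $p \in (0,1]$ and let $n \ge 1$ be an integer. Let $\nu_p^n$ be the probability measure on $\mathbb{R}^n$ with density $$\mathrm{d}\nu_p^n(x) = (c_p/2)^n e^{-\sum_{i=1}^n |x_i|^p}\,\mathrm{d}x, \qquad c_p = \frac{1}{\Gamma(1+1/p)}.$$ Then $\nu_p^n$ supports the S-inequality for all ideals in $\mathbb{R}^n$.
   Context: For a Borel measure $\mu$ on $\mathbb{R}$, $\mu^n = \mu^{\otimes n}$ denotes its $n$-fold product measure on $\mathbb{R}^n$; here $\nu_p^n$ is the $n$-fold product of $\nu_p = \nu_p^1$. A product measure $\mu^n$ on $\mathbb{R}^n$ supports the S-inequality for a Borel set $L \subset \mathbb{R}^n$ if for any dilation $K = sL$, $s>0$, and any strip $P = \{x \in \mathbb{R}^n : |x_1| \le w\}$ (with $w \ge 0$) we have $$\mu^n(K) = \mu^n(P) \quad\Longrightarrow\quad \mu^n(tK) \ge \mu^n(tP) \ \text{ for all } t \ge 1.$$ A set $K \subset \mathbb{R}^n$ is called an ideal if along with each of its points $x \in K$ it contains the cube $[-|x_1|,|x_1|] \times \cdots \times [-|x_n|,|x_n|]$. "Supports the S-inequality for all ideals" means for every Borel set that is an ideal. *)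

theory Defs
  imports "HOL-Probability.Probability"
begin

text \<open>
  Points of \<open>n\<close>-space are the extensional functions on \<open>{1..n}\<close>, with coordinates
  \<open>x 1, \<dots>, x n\<close>. Since the reals are second countable, the product sigma-algebra of
  \<open>borel_Rn n\<close> is the Borel sigma-algebra of \<open>n\<close>-space.
\<close>

definition borel_Rn :: "nat \<Rightarrow> (nat \<Rightarrow> real) measure" where
  "borel_Rn n = (\<Pi>\<^sub>M i\<in>{1..n}. borel)"

definition lborel_Rn :: "nat \<Rightarrow> (nat \<Rightarrow> real) measure" where
  "lborel_Rn n = (\<Pi>\<^sub>M i\<in>{1..n}. lborel)"

definition dilate :: "nat \<Rightarrow> real \<Rightarrow> (nat \<Rightarrow> real) set \<Rightarrow> (nat \<Rightarrow> real) set" where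
  "dilate n s L = (\<lambda>x. \<lambda>i\<in>{1..n}. s * x i) ` L"

definition strip :: "nat \<Rightarrow> real \<Rightarrow> (nat \<Rightarrow> real) set" where
  "strip n w = {x \<in> space (borel_Rn n). \<bar>x 1\<bar> \<le> w}"

definition is_ideal :: "nat \<Rightarrow> (nat \<Rightarrow> real) set \<Rightarrow> bool" where
  "is_ideal n K \<longleftrightarrow> K \<subseteq> space (borel_Rn n) \<and>
     (\<forall>x\<in>K. (\<Pi>\<^sub>E i\<in>{1..n}. {-\<bar>x i\<bar>..\<bar>x i\<bar>}) \<subseteq> K)"

definition supports_S_inequality ::
  "nat \<Rightarrow> (nat \<Rightarrow> real) measure \<Rightarrow> (nat \<Rightarrow> real) set \<Rightarrow> bool" where
  "supports_S_inequality n M L \<longleftrightarrow>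
     (\<forall>s>0. \<forall>w\<ge>0. emeasure M (dilate n s L) = emeasure M (strip n w) \<longrightarrow>
        (\<forall>t\<ge>1. emeasure M (dilate n t (dilate n s L)) \<ge> emeasure M (dilate n t (strip n w))))"

definition nu_const :: "real \<Rightarrow> real" where
  "nu_const p = 1 / Gamma (1 + 1 / p)"

definition nu :: "real \<Rightarrow> nat \<Rightarrow> (nat \<Rightarrow> real) measure" where
  "nu p n = density (lborel_Rn n)
     (\<lambda>x. ennreal ((nu_const p / 2) ^ n * exp (- (\<Sum>i=1..n. \<bar>x i\<bar> powr p))))"

definition nu_line :: "real \<Rightarrow> real measure" where
  "nu_line p = density lborel (\<lambda>x. ennreal (nu_const p / 2 * exp (- (\<bar>x\<bar> powr p))))"

lemma sets_nu: "sets (nu p n) = sets (borel_Rn n)"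
  unfolding nu_def lborel_Rn_def borel_Rn_def by (simp cong: sets_PiM_cong)

lemma nn_integral_exp_powr:
  fixes p :: real
  assumes "0 < p"
  shows "(\<integral>\<^sup>+x. ennreal (exp (- (\<bar>x\<bar> powr p))) \<partial>lborel) = ennreal (2 * Gamma (1 + 1 / p))"
proof -
  let ?f = "\<lambda>x::real. exp (- (\<bar>x\<bar> powr p))"
  let ?g = "\<lambda>y::real. y powr (1 / p)"
  let ?g' = "\<lambda>y::real. (1 / p) * y powr (1 / p - 1)"
  have img: "?g ` {0<..} = {0<..}"
  proof (intro equalityI subsetI)
    fix x :: real assume "x \<in> {0<..}"
    then have "x = ?g (x powr p)" "x powr p \<in> {0<..}"
      using assms by (auto simp: powr_powr)
    then show "x \<in> ?g ` {0<..}" by blast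
  qed auto
  have inj: "inj_on ?g {0<..}"
  proof (rule inj_onI)
    fix x y :: real
    assume xy: "x \<in> {0<..}" "y \<in> {0<..}" "?g x = ?g y"
    have "x = (?g x) powr p" "y = (?g y) powr p"
      using xy(1,2) assms by (simp_all add: powr_powr)
    then show "x = y" using xy(3) by metis
  qed
  have G: "((\<lambda>t. t powr (1 / p - 1) / exp t) has_integral Gamma (1 / p)) {0..}"
    using Gamma_integral_real[of "1 / p"] assms by simp
  have G': "((\<lambda>t. t powr (1 / p - 1) / exp t) has_integral Gamma (1 / p)) {0<..}"
    by (rule has_integral_spike_set_eq[THEN iffD1, OF _ _ G])
       (auto intro: negligible_subset[of "{0}"])
  have eq: "\<bar>?g' y\<bar> * ?f (?g y) = (1 / p) * (y powr (1 / p - 1) / exp y)" if "y \<in> {0<..}" for y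
    using that assms by (simp add: powr_powr exp_minus field_simps)
  have Gam: "(1 / p) * Gamma (1 / p) = Gamma (1 + 1 / p)"
  proof -
    have "1 / p \<notin> \<int>\<^sub>\<le>\<^sub>0"
      using assms nonpos_Ints_nonpos[of "1 / p"] by (auto simp: field_simps)
    then show ?thesis
      using Gamma_plus1[of "1 / p"] by (simp add: add.commute)
  qed
  have I: "((\<lambda>y. \<bar>?g' y\<bar> * ?f (?g y)) has_integral Gamma (1 + 1 / p)) {0<..}"
    unfolding Gam[symmetric]
    by (rule has_integral_cong[THEN iffD2, OF _ has_integral_mult_right[OF G']]) (rule eq)
  have "(\<lambda>y. \<bar>?g' y\<bar> * ?f (?g y)) absolutely_integrable_on {0<..}"
    by (rule nonnegative_absolutely_integrable_1) (use I in \<open>auto simp: integrable_on_def\<close>)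
  then have "?f absolutely_integrable_on (?g ` {0<..}) \<and>
    integral (?g ` {0<..}) ?f = Gamma (1 + 1 / p)"
    using integral_unique[OF I] assms
    by (subst has_absolute_integral_change_of_variables_1'[symmetric, where g' = ?g'])
       (auto intro!: derivative_eq_intros inj)
  then have half: "(?f has_integral Gamma (1 + 1 / p)) {0<..}"
    unfolding img by (metis absolutely_integrable_on_def integrable_integral)
  have nn: "(\<integral>\<^sup>+x. ennreal (?f x) * indicator {0<..} x \<partial>lborel) = ennreal (Gamma (1 + 1 / p))"
    using nn_integral_has_integral_lebesgue[OF _ half]
    by (simp add: mult.commute ennreal_mult' ennreal_indicator)
  have nn': "(\<integral>\<^sup>+x. ennreal (?f x) * indicator {..<0} x \<partial>lborel) = ennreal (Gamma (1 + 1 / p))"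
    unfolding nn[symmetric]
    by (subst nn_integral_real_affine[of _ "-1" 0])
       (auto simp: indicator_def intro!: nn_integral_cong)
  have "(\<integral>\<^sup>+x. ennreal (?f x) \<partial>lborel) =
    (\<integral>\<^sup>+x. ennreal (?f x) * indicator {0<..} x + ennreal (?f x) * indicator {..<0} x \<partial>lborel)"
    by (intro nn_integral_cong_AE AE_I[of _ _ "{0}"]) (auto simp: indicator_def)
  also have "\<dots> = ennreal (Gamma (1 + 1 / p)) + ennreal (Gamma (1 + 1 / p))"
    by (subst nn_integral_add) (auto simp: nn nn')
  finally show ?thesis
    using assms by (simp flip: ennreal_plus add: Gamma_real_pos less_imp_le add_pos_pos)
qed

lemma nu_const_pos: "0 < p \<Longrightarrow> 0 < nu_const p"
  by (simp add: nu_const_def Gamma_real_pos add_pos_pos)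

lemma prob_space_nu_line:
  assumes "0 < p"
  shows "prob_space (nu_line p)"
proof
  have G: "Gamma (1 + 1 / p) > 0"
    using assms by (intro Gamma_real_pos add_pos_pos) auto
  have "emeasure (nu_line p) (space (nu_line p)) =
      (\<integral>\<^sup>+x. ennreal (nu_const p / 2) * ennreal (exp (- (\<bar>x\<bar> powr p))) \<partial>lborel)"
    using nu_const_pos[OF assms]
    by (simp add: nu_line_def emeasure_density flip: ennreal_mult)
  also have "\<dots> = ennreal (nu_const p / 2) * ennreal (2 * Gamma (1 + 1 / p))"
    by (simp add: nn_integral_cmult nn_integral_exp_powr[OF assms])
  also have "\<dots> = 1"
    using G by (simp add: nu_const_def flip: ennreal_mult)
  finally show "emeasure (nu_line p) (space (nu_line p)) = 1" .
qed

lemma nu_eq_product: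
  assumes "0 < p"
  shows "nu p n = (\<Pi>\<^sub>M i\<in>{1..n}. nu_line p)"
proof -
  interpret L: product_sigma_finite "\<lambda>_::nat. lborel :: real measure"
    by unfold_locales
  interpret P: prob_space "nu_line p"
    by (rule prob_space_nu_line[OF assms])
  interpret N: product_sigma_finite "\<lambda>_::nat. nu_line p"
    by unfold_locales
  let ?h = "\<lambda>x::real. ennreal (nu_const p / 2 * exp (- (\<bar>x\<bar> powr p)))"
  have dens: "ennreal ((nu_const p / 2) ^ n * exp (- (\<Sum>i=1..n. \<bar>x i\<bar> powr p))) =
      (\<Prod>i=1..n. ?h (x i))" for x
    using nu_const_pos[OF assms]
    by (simp add: prod_ennreal prod.distrib prod_dividef exp_sum power_divide flip: sum_negf)
  show ?thesis
  proof (rule N.PiM_eqI)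
    show "sets (nu p n) = sets (\<Pi>\<^sub>M i\<in>{1..n}. nu_line p)"
      unfolding nu_def lborel_Rn_def nu_line_def by (simp cong: sets_PiM_cong)
  next
    fix A :: "nat \<Rightarrow> real set"
    assume A: "\<And>i. i \<in> {1..n} \<Longrightarrow> A i \<in> sets (nu_line p)"
    then have A': "\<And>i. i \<in> {1..n} \<Longrightarrow> A i \<in> sets borel"
      by (simp add: nu_line_def)
    have box: "Pi\<^sub>E {1..n} A \<in> sets (\<Pi>\<^sub>M i\<in>{1..n}. lborel :: real measure)"
      by (intro sets_PiM_I_finite) (simp_all only: sets_lborel A' finite_atLeastAtMost)
    have "emeasure (nu p n) (Pi\<^sub>E {1..n} A) =
        (\<integral>\<^sup>+x. (\<Prod>i=1..n. ?h (x i)) * indicator (Pi\<^sub>E {1..n} A) x \<partial>(\<Pi>\<^sub>M i\<in>{1..n}. lborel))"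
      unfolding nu_def lborel_Rn_def dens
      by (intro emeasure_density box) measurable
    also have "\<dots> = (\<integral>\<^sup>+x. (\<Prod>i=1..n. ?h (x i) * indicator (A i) (x i)) \<partial>(\<Pi>\<^sub>M i\<in>{1..n}. lborel))"
    proof (rule nn_integral_cong)
      fix x assume "x \<in> space (\<Pi>\<^sub>M i\<in>{1..n}. lborel :: real measure)"
      then have "indicator (Pi\<^sub>E {1..n} A) x = (\<Prod>i=1..n. indicator (A i) (x i) :: ennreal)"
        by (auto simp: indicator_def space_PiM PiE_iff prod_zero_iff)
      then show "(\<Prod>i=1..n. ?h (x i)) * indicator (Pi\<^sub>E {1..n} A) x =
          (\<Prod>i=1..n. ?h (x i) * indicator (A i) (x i))"
        by (simp add: prod.distrib)
    qed
    also have "\<dots> = (\<Prod>i=1..n. \<integral>\<^sup>+x. ?h x * indicator (A i) x \<partial>lborel)"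
      using A' by (intro L.product_nn_integral_prod) auto
    also have "\<dots> = (\<Prod>i=1..n. emeasure (nu_line p) (A i))"
      using A' by (intro prod.cong refl) (simp add: nu_line_def emeasure_density)
    finally show "emeasure (nu p n) (Pi\<^sub>E {1..n} A) = (\<Prod>i=1..n. emeasure (nu_line p) (A i))" .
  qed simp
qed

lemma prob_space_nu:
  assumes "0 < p"
  shows "prob_space (nu p n)"
  unfolding nu_eq_product[OF assms] by (intro prob_space_PiM prob_space_nu_line assms)

end

theory Submission
  imports Defs "HOL-Real_Asymp.Real_Asymp"
begin

text \<open>
  Let \<open>profile a\<close> be the integral of \<open>p * \<bar>x\<bar> powr p\<close> under \<open>nu_line p\<close> over the symmetric
  interval of measure \<open>a\<close>; by parts, it is \<open>a - w * nu_const p * exp (- (w powr p))\<close> for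
  the interval \<open>[-w, w]\<close>. Differentiating the measure of \<open>t K\<close> in \<open>t\<close> reduces the
  S-inequality to the bound \<open>(n - 1) * a + profile a\<close> on the integral of
  \<open>\<Sum>i. p * \<bar>x i\<bar> powr p\<close> over an ideal \<open>K\<close> of measure \<open>a\<close>. This is an equality in dimension
  one, and it tensorises as soon as the functional \<open>E (profile f) - profile (E f)\<close> is convex
  in \<open>f\<close>, which by the condition of Latala and Oleszkiewicz holds when the reciprocal of the
  second derivative of \<open>profile\<close> is concave. That reciprocal is proportional to
  \<open>w powr (1 - p) * exp (- (w powr p))\<close>, and its concavity is where \<open>p \<le> 1\<close> enters.
\<close>

section \<open>Tensorisation of entropy functionals\<close>

text \<open>Let K have measure a. At t = 1 the measure of t K changes at rate n * a minus the
  integral of the sum of p * |x i| powr p over K, so the bound (n - 1) * a + profile a leaves a rate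
  of at least a - profile a. For a strip of half-width w this number is w * nu_const p * exp (- (w
  powr p)), exactly the rate at which the strip grows. A strip attains the bound: each of its n - 1
  free coordinates has full moment 1 and contributes a.

  Convexity tensorises through Jensen: E_1 V(E_2 f) - V(E f) is at most the E_2-mean of E_1 V(f) -
  V(E_1 f). For the indicator of K one has V(f) = f, and the two inner expectations are measures of
  slices of K in the two directions. Slices of ideals are ideals, which allows an induction on the
  dimension.

  Two obstacles shape the proof. The slope of \<open>profile\<close> is unbounded near 1, where
  indicators take their values, so the inequality is first shown away from 0 and 1. And the measure
  of t K is only known to be monotone in t, so finite growth bounds replace its derivative.\<close>

lemma convex_combination_in_interval:
  fixes a b t :: real
  assumes "a \<in> {l<..<u}" "b \<in> {l<..<u}" "0 \<le> t" "t \<le> 1"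
  shows "a + t * (b - a) \<in> {l<..<u}"
proof -
  have "(1 - t) *\<^sub>R a + t *\<^sub>R b \<in> {l<..<u}"
    using assms by (intro convexD) auto
  then show ?thesis by (simp add: algebra_simps)
qed

section \<open>Bounded measurable functions\<close>

definition bounded_measurable :: "'a measure \<Rightarrow> ('a \<Rightarrow> real) \<Rightarrow> bool" where
  "bounded_measurable M f \<longleftrightarrow> f \<in> borel_measurable M \<and> (\<exists>B. \<forall>x\<in>space M. \<bar>f x\<bar> \<le> B)"

lemma bounded_measurable_add:
  assumes "bounded_measurable M f" "bounded_measurable M g"
  shows "bounded_measurable M (\<lambda>x. f x + g x)"
proof -
  obtain A B where "\<forall>x\<in>space M. \<bar>f x\<bar> \<le> A" "\<forall>x\<in>space M. \<bar>g x\<bar> \<le> B"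
    using assms by (auto simp: bounded_measurable_def)
  then have "\<forall>x\<in>space M. \<bar>f x + g x\<bar> \<le> A + B"
    by (meson abs_triangle_ineq add_mono order_trans)
  then show ?thesis using assms by (auto simp: bounded_measurable_def)
qed

lemma bounded_measurable_mult:
  assumes "bounded_measurable M f" "bounded_measurable M g"
  shows "bounded_measurable M (\<lambda>x. f x * g x)"
proof -
  obtain A B where "\<forall>x\<in>space M. \<bar>f x\<bar> \<le> A" "\<forall>x\<in>space M. \<bar>g x\<bar> \<le> B"
    using assms by (auto simp: bounded_measurable_def)
  then have "\<forall>x\<in>space M. \<bar>f x * g x\<bar> \<le> A * B"
    unfolding abs_mult by (intro ballI mult_mono) (auto intro: order_trans[OF abs_ge_zero])
  then show ?thesis using assms by (auto simp: bounded_measurable_def)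
qed

lemma bounded_measurable_const: "bounded_measurable M (\<lambda>_. c)"
  by (auto simp: bounded_measurable_def)

lemma bounded_measurable_diff:
  "bounded_measurable M f \<Longrightarrow> bounded_measurable M g \<Longrightarrow> bounded_measurable M (\<lambda>x. f x - g x)"
  using bounded_measurable_add[OF _ bounded_measurable_mult[OF bounded_measurable_const[of M "-1"]]]
  by fastforce

text \<open>The bound is required at every point rather than almost everywhere so that it passes to
  sections along y |-> (x, y), which do not respect null sets.\<close>

lemma bounded_measurable_compose:
  assumes "bounded_measurable N f" and h: "h \<in> measurable M N"
  shows "bounded_measurable M (\<lambda>x. f (h x))"
  using assms measurable_space[OF h] by (auto simp: bounded_measurable_def)

lemma bounded_measurable_continuous_compose:
  assumes k: "k \<in> borel_measurable M" and range: "\<And>x. x \<in> space M \<Longrightarrow> k x \<in> {l..u::real}"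
    and h: "continuous_on {l..u} h"
  shows "bounded_measurable M (\<lambda>x. h (k x))"
proof -
  have "compact (h ` {l..u})"
    by (intro compact_continuous_image h) simp
  then have "bounded (h ` {l..u})"
    by (rule compact_imp_bounded)
  then obtain B where B: "\<forall>y\<in>{l..u}. \<bar>h y\<bar> \<le> B"
    by (auto simp: bounded_real)
  \<comment> \<open>\<open>h\<close> is controlled only on the interval and need not be measurable
    outside; cutting it off gives a Borel function that agrees with it on the range of
    \<open>k\<close>.\<close>
  have "(\<lambda>x. indicator {l..u} x *\<^sub>R h x) \<in> borel_measurable borel"
    by (intro borel_measurable_continuous_on_indicator h) simp
  from measurable_compose[OF k this] have "(\<lambda>x. indicator {l..u} (k x) *\<^sub>R h (k x)) \<in> borel_measurable M" .
  then have "(\<lambda>x. h (k x)) \<in> borel_measurable M"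
    by (rule measurable_cong[THEN iffD1, rotated]) (use range in simp)
  moreover have "\<forall>x\<in>space M. \<bar>h (k x)\<bar> \<le> B"
    using B range by blast
  ultimately show ?thesis by (auto simp: bounded_measurable_def)
qed

lemma (in finite_measure) integrable_bounded_measurable:
  assumes "bounded_measurable M f"
  shows "integrable M f"
proof -
  obtain B where "\<forall>x\<in>space M. \<bar>f x\<bar> \<le> B" "f \<in> borel_measurable M"
    using assms by (auto simp: bounded_measurable_def)
  then show ?thesis by (intro integrable_const_bound[where B = B] AE_I2) auto
qed

lemmas bounded_measurable_intros =
  bounded_measurable_add bounded_measurable_mult bounded_measurable_const bounded_measurable_diff

lemma (in prob_space) expectation_in_interval:
  fixes f :: "'a \<Rightarrow> real"
  assumes f: "f \<in> borel_measurable M" and range: "\<And>x. x \<in> space M \<Longrightarrow> f x \<in> {l..u}"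
  shows "expectation f \<in> {l..u}"
proof -
  have "integrable M f"
    using bounded_measurable_continuous_compose[OF f range continuous_on_id]
    by (intro integrable_bounded_measurable) simp
  then have "(\<integral>x. l \<partial>M) \<le> expectation f" "expectation f \<le> (\<integral>x. u \<partial>M)"
    using range by (intro integral_mono; simp)+
  then show ?thesis by (simp add: prob_space)
qed

lemma (in pair_sigma_finite) integral_snd':
  fixes f :: "_ \<Rightarrow> _::{banach, second_countable_topology}"
  assumes "integrable (M1 \<Otimes>\<^sub>M M2) f"
  shows "(\<integral>y. (\<integral>x. f (x, y) \<partial>M1) \<partial>M2) = integral\<^sup>L (M1 \<Otimes>\<^sub>M M2) f"
  using integral_snd[of "\<lambda>x y. f (x, y)"] assms by simp

section \<open>Entropy functionals and joint convexity of the divergence\<close>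

text \<open>\<open>J\<close> is V', \<open>R\<close> is 1 / V'' and \<open>r\<close> is R', so
  \<open>r_antimono\<close> is concavity of 1 / V''. Derivatives are asked only inside the interval
  because the slope of \<open>profile\<close> is unbounded near 1; continuity and the values at the
  end points are there for indicators.\<close>

locale entropy_function =
  fixes V J R r :: "real \<Rightarrow> real"
  assumes V_deriv: "\<And>a. a \<in> {0<..<1} \<Longrightarrow> (V has_real_derivative J a) (at a)"
    and J_deriv: "\<And>a. a \<in> {0<..<1} \<Longrightarrow> (J has_real_derivative 1 / R a) (at a)"
    and R_deriv: "\<And>a. a \<in> {0<..<1} \<Longrightarrow> (R has_real_derivative r a) (at a)"
    and R_pos: "\<And>a. a \<in> {0<..<1} \<Longrightarrow> 0 < R a"
    and r_antimono: "\<And>a b. 0 < a \<Longrightarrow> a \<le> b \<Longrightarrow> b < 1 \<Longrightarrow> r b \<le> r a"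
    and V_cont: "continuous_on {0..1} V"
    and V_0: "V 0 = 0" and V_1: "V 1 = 1"
begin

lemma R_below_tangent:
  assumes "x \<in> {0<..<1}" "y \<in> {0<..<1}"
  shows "R x \<le> R y + r y * (x - y)"
proof (cases x y rule: linorder_cases)
  case less
  then obtain z where "x < z" "z < y" "R y - R x = (y - x) * r z"
    using MVT2[of x y R r] R_deriv assms by auto
  moreover have "(y - x) * r y \<le> (y - x) * r z"
    using calculation less assms by (intro mult_left_mono r_antimono) auto
  ultimately show ?thesis by (simp add: algebra_simps)
next
  case greater
  then obtain z where "y < z" "z < x" "R x - R y = (x - y) * r z"
    using MVT2[of y x R r] R_deriv assms by auto
  moreover have "(x - y) * r z \<le> (x - y) * r y"
    using calculation greater assms by (intro mult_left_mono r_antimono) auto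
  ultimately show ?thesis by (simp add: algebra_simps)
qed simp

text \<open>When y is the mean of x the linear term averages out, and the expected divergence is E
  V(x) - V(E x). Joint convexity in (x, y) therefore passes to that functional.\<close>

definition bregman :: "real \<Rightarrow> real \<Rightarrow> real" where
  "bregman x y = V x - V y - J y * (x - y)"

text \<open>Concavity of \<open>R\<close> is what makes the Hessian of \<open>bregman\<close> nonnegative.\<close>

lemma bregman_hessian_nonneg:
  assumes x: "x \<in> {0<..<1}" and y: "y \<in> {0<..<1}"
  shows "0 \<le> (h / R x - k / R y) * h + (r y / (R y)\<^sup>2) * k\<^sup>2 * (x - y) - k / R y * (h - k)"
proof -
  have Rx: "0 < R x" and Ry: "0 < R y" using R_pos x y by auto
  \<comment> \<open>Expanding the square leaves one term with factor \<open>R x\<close>; replacing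
    it there by the tangent of \<open>R\<close> at y produces the second derivative.\<close>
  have "0 \<le> (h / R x - k / R y)\<^sup>2 * R x" using Rx by simp
  also have "\<dots> = h\<^sup>2 / R x - 2 * h * k / R y + (k / R y)\<^sup>2 * R x"
    using Rx Ry by (simp add: power2_eq_square field_simps)
  also have "\<dots> \<le> h\<^sup>2 / R x - 2 * h * k / R y + (k / R y)\<^sup>2 * (R y + r y * (x - y))"
    using R_below_tangent[OF x y] by (intro add_left_mono mult_left_mono) auto
  also have "\<dots> = (h / R x - k / R y) * h + (r y / (R y)\<^sup>2) * k\<^sup>2 * (x - y) - k / R y * (h - k)"
    using Rx Ry by (simp add: power2_eq_square field_simps)
  finally show ?thesis .
qed

text \<open>The gradient of \<open>bregman\<close> at (a, b) is (J a - J b, - (a - b) / R b). On the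
  segment from (a, b) to (f, g) the derivative \<open>q'\<close> is nondecreasing, as
  \<open>q''\<close> is the Hessian in direction (h, k), so the mean value theorem puts the function
  above its tangent.\<close>

lemma bregman_above_tangent:
  assumes f: "f \<in> {0<..<1}" and g: "g \<in> {0<..<1}" and a: "a \<in> {0<..<1}" and b: "b \<in> {0<..<1}"
  shows "bregman a b + (J a - J b) * (f - a) - (a - b) / R b * (g - b) \<le> bregman f g"
proof -
  define X where "X t = a + t * (f - a)" for t
  define Y where "Y t = b + t * (g - b)" for t
  define h k where "h = f - a" and "k = g - b"
  define q' where "q' t = (J (X t) - J (Y t)) * h - k / R (Y t) * (X t - Y t)" for t
  define q'' where "q'' t = (h / R (X t) - k / R (Y t)) * h
    + (r (Y t) / (R (Y t))\<^sup>2) * k\<^sup>2 * (X t - Y t) - k / R (Y t) * (h - k)" for t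
  have X: "X t \<in> {0<..<1}" and Y: "Y t \<in> {0<..<1}" if "0 \<le> t" "t \<le> 1" for t
    unfolding X_def Y_def using assms that by (intro convex_combination_in_interval; simp)+
  have dX: "(X has_real_derivative h) (at t)" and dY: "(Y has_real_derivative k) (at t)" for t
    unfolding X_def[abs_def] Y_def[abs_def] h_def k_def by (auto intro!: derivative_eq_intros)
  have dq: "((\<lambda>t. bregman (X t) (Y t)) has_real_derivative q' t) (at t)"
    if t: "0 \<le> t" "t \<le> 1" for t
    unfolding bregman_def q'_def
    by (rule derivative_eq_intros dX dY refl DERIV_chain2[OF V_deriv[OF X[OF t]] dX]
          DERIV_chain2[OF V_deriv[OF Y[OF t]] dY] DERIV_chain2[OF J_deriv[OF Y[OF t]] dY])+
       (simp add: algebra_simps)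
  have dq': "(q' has_real_derivative q'' t) (at t)" if t: "0 \<le> t" "t \<le> 1" for t
    unfolding q'_def[abs_def] q''_def using R_pos[OF Y[OF t]]
    by (auto intro!: derivative_eq_intros dX dY DERIV_chain2[OF J_deriv[OF X[OF t]] dX]
          DERIV_chain2[OF J_deriv[OF Y[OF t]] dY] DERIV_chain2[OF R_deriv[OF Y[OF t]] dY]
          simp: power2_eq_square field_simps)
  obtain z where z: "0 < z" "z < 1" "bregman (X 1) (Y 1) - bregman (X 0) (Y 0) = q' z"
    using MVT2[of 0 1 "\<lambda>t. bregman (X t) (Y t)" q'] dq by auto
  have "q' 0 \<le> q' z"
  proof (rule DERIV_nonneg_imp_nondecreasing[of 0 z q'])
    fix t assume "0 \<le> t" "t \<le> z"
    then have t: "0 \<le> t" "t \<le> 1" using z by auto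
    have "0 \<le> q'' t" unfolding q''_def by (rule bregman_hessian_nonneg[OF X[OF t] Y[OF t]])
    with dq'[OF t] show "\<exists>y. (q' has_real_derivative y) (at t) \<and> 0 \<le> y" by auto
  qed (use z in simp)
  moreover have "q' 0 = (J a - J b) * (f - a) - (a - b) / R b * (g - b)"
    by (simp add: X_def Y_def q'_def h_def k_def)
  ultimately show ?thesis using z(3) by (simp add: X_def Y_def)
qed

section \<open>The entropy inequality in two variables\<close>

text \<open>Jensen's inequality through supporting tangents: the divergence of f(x, y) from its mean
  \<open>g x\<close> over y is bounded below by the tangent at (a y, b), which is the pair (f(x, y),
  g x) averaged over x. Values in a compact part of the open interval keep \<open>J\<close> bounded
  and every term integrable.\<close>

lemma entropy_two_variables_interior:
  assumes "prob_space M1" "prob_space M2"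
    and f: "f \<in> borel_measurable (M1 \<Otimes>\<^sub>M M2)" and range: "\<And>z. z \<in> space (M1 \<Otimes>\<^sub>M M2) \<Longrightarrow> f z \<in> {l..u}"
    and l: "0 < l" and u: "u < 1"
  shows "(\<integral>x. V (\<integral>y. f (x, y) \<partial>M2) \<partial>M1) + (\<integral>y. V (\<integral>x. f (x, y) \<partial>M1) \<partial>M2)
    \<le> V (\<integral>z. f z \<partial>(M1 \<Otimes>\<^sub>M M2)) + (\<integral>z. V (f z) \<partial>(M1 \<Otimes>\<^sub>M M2))"
proof -
  interpret M1: prob_space M1 by fact
  interpret M2: prob_space M2 by fact
  interpret P: pair_prob_space M1 M2 ..
  let ?P = "M1 \<Otimes>\<^sub>M M2"
  define g where "g x = (\<integral>y. f (x, y) \<partial>M2)" for x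
  define a where "a y = (\<integral>x. f (x, y) \<partial>M1)" for y
  define b where "b = (\<integral>z. f z \<partial>?P)"
  note f[measurable]
  have fx: "(\<lambda>y. f (x, y)) \<in> borel_measurable M2" if "x \<in> space M1" for x
    using that by measurable
  have fy: "(\<lambda>x. f (x, y)) \<in> borel_measurable M1" if "y \<in> space M2" for y
    using that by measurable
  have sub: "{l..u} \<subseteq> {0<..<1}" using l u by auto
  have cV: "continuous_on {l..u} V"
    by (rule continuous_on_subset[OF V_cont]) (use l u in auto)
  have cJ: "continuous_on {l..u} J"
    using sub by (intro continuous_at_imp_continuous_on ballI DERIV_isCont[OF J_deriv]) auto
  have space: "(x, y) \<in> space ?P" if "x \<in> space M1" "y \<in> space M2" for x y
    using that by (simp add: space_pair_measure)
  have gm[measurable]: "g \<in> borel_measurable M1" and am[measurable]: "a \<in> borel_measurable M2"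
    unfolding g_def a_def by measurable
  have g: "g x \<in> {l..u}" if "x \<in> space M1" for x
    unfolding g_def by (rule M2.expectation_in_interval[OF fx[OF that] range[OF space[OF that]]])
  have a: "a y \<in> {l..u}" if "y \<in> space M2" for y
    unfolding a_def by (rule M1.expectation_in_interval[OF fy[OF that] range[OF space[OF _ that]]])
  have b: "b \<in> {l..u}"
    unfolding b_def by (rule P.expectation_in_interval[OF f range])
  have g': "g (fst z) \<in> {l..u}" and a': "a (snd z) \<in> {l..u}" if "z \<in> space ?P" for z
    using that g a by (auto simp: space_pair_measure)
  note int = P.integrable_bounded_measurable M1.integrable_bounded_measurable
    M2.integrable_bounded_measurable
  have bf: "bounded_measurable ?P f"
    by (rule bounded_measurable_continuous_compose[OF f range continuous_on_id])
  have bg: "bounded_measurable M1 g" and bga: "bounded_measurable M2 a"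
    by (rule bounded_measurable_continuous_compose[OF gm g continuous_on_id]
        bounded_measurable_continuous_compose[OF am a continuous_on_id]; assumption)+
  have bVg: "bounded_measurable M1 (\<lambda>x. V (g x))" and bJg: "bounded_measurable M1 (\<lambda>x. J (g x))"
    by (rule bounded_measurable_continuous_compose[OF gm g cV]
        bounded_measurable_continuous_compose[OF gm g cJ]; assumption)+
  have bVa: "bounded_measurable M2 (\<lambda>x. V (a x))" and bJa: "bounded_measurable M2 (\<lambda>x. J (a x))"
    by (rule bounded_measurable_continuous_compose[OF am a cV]
        bounded_measurable_continuous_compose[OF am a cJ]; assumption)+
  have bVf: "bounded_measurable ?P (\<lambda>x. V (f x))"
    by (rule bounded_measurable_continuous_compose[OF f range cV])
  note fsts = bg[THEN bounded_measurable_compose, OF measurable_fst]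
    bVg[THEN bounded_measurable_compose, OF measurable_fst]
    bJg[THEN bounded_measurable_compose, OF measurable_fst]
    bga[THEN bounded_measurable_compose, OF measurable_snd]
    bVa[THEN bounded_measurable_compose, OF measurable_snd]
    bJa[THEN bounded_measurable_compose, OF measurable_snd]
  note I = bf bVf fsts bounded_measurable_intros
  have bfx: "bounded_measurable M2 (\<lambda>y. f (x, y))" if "x \<in> space M1" for x
    by (rule bounded_measurable_compose[OF bf]) (use that in measurable)
  have bfy: "bounded_measurable M1 (\<lambda>x. f (x, y))" if "y \<in> space M2" for y
    by (rule bounded_measurable_compose[OF bf]) (use that in measurable)
  \<comment> \<open>The terms that must integrate to zero: \<open>?F1\<close> over y since
    \<open>g\<close> is the mean of f in y, \<open>?F2\<close> over x since \<open>a\<close> is the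
    mean in x, and \<open>?F3\<close> because it is a product of centred functions of separate
    variables.\<close>
  let ?F1 = "\<lambda>z. J (g (fst z)) * (f z - g (fst z))"
  let ?F2 = "\<lambda>z. (J (a (snd z)) - J b) * (f z - a (snd z))"
  let ?F3 = "\<lambda>z. (a (snd z) - b) * (1 / R b) * (g (fst z) - b)"
  have Eg: "(\<integral>x. g x \<partial>M1) = b"
    unfolding g_def b_def by (rule P.integral_fst'[OF int(1)[OF bf]])
  have Ea: "(\<integral>y. a y \<partial>M2) = b"
    unfolding a_def b_def by (rule P.integral_snd'[OF int(1)[OF bf]])
  have F1: "(\<integral>z. ?F1 z \<partial>?P) = 0"
  proof -
    have "(\<integral>z. ?F1 z \<partial>?P) = (\<integral>x. \<integral>y. ?F1 (x, y) \<partial>M2 \<partial>M1)"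
      by (rule P.integral_fst'[symmetric, OF int(1)]) (intro I)
    also have "\<dots> = (\<integral>x. 0 \<partial>M1)"
      using int(3)[OF bfx] by (intro Bochner_Integration.integral_cong refl)
        (simp add: M2.prob_space g_def)
    finally show ?thesis by simp
  qed
  have F2: "(\<integral>z. ?F2 z \<partial>?P) = 0"
  proof -
    have "(\<integral>z. ?F2 z \<partial>?P) = (\<integral>y. \<integral>x. ?F2 (x, y) \<partial>M1 \<partial>M2)"
      by (rule P.integral_snd'[symmetric, OF int(1)]) (intro I)
    also have "\<dots> = (\<integral>y. 0 \<partial>M2)"
      using int(2)[OF bfy] by (intro Bochner_Integration.integral_cong refl)
        (simp add: M1.prob_space a_def)
    finally show ?thesis by simp
  qed
  have F3: "(\<integral>z. ?F3 z \<partial>?P) = 0"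
  proof -
    have "(\<integral>z. ?F3 z \<partial>?P) = (\<integral>x. \<integral>y. ?F3 (x, y) \<partial>M2 \<partial>M1)"
      by (rule P.integral_fst'[symmetric, OF int(1)]) (intro I)
    also have "\<dots> = (\<integral>x. 0 \<partial>M1)"
      using int(3)[OF bga] by (intro Bochner_Integration.integral_cong refl)
        (simp add: M2.prob_space Ea)
    finally show ?thesis by simp
  qed
  have EVg: "(\<integral>z. V (g (fst z)) \<partial>?P) = (\<integral>x. V (g x) \<partial>M1)"
    by (subst P.integral_fst'[symmetric, OF int(1)]) (intro I, simp add: M2.prob_space)
  have EVa: "(\<integral>z. V (a (snd z)) \<partial>?P) = (\<integral>x. V (a x) \<partial>M2)"
    by (subst P.integral_fst'[symmetric, OF int(1)]) (intro I, simp add: M1.prob_space)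
  have Ea': "(\<integral>z. a (snd z) \<partial>?P) = b"
    by (subst P.integral_fst'[symmetric, OF int(1)]) (intro I, simp add: M1.prob_space Ea)
  have "(\<integral>z. V (a (snd z)) - V b - J b * (a (snd z) - b) + ?F2 z - ?F3 z \<partial>?P)
      \<le> (\<integral>z. V (f z) - V (g (fst z)) - ?F1 z \<partial>?P)"
  proof (rule integral_mono)
    fix z assume z: "z \<in> space ?P"
    have "f z \<in> {0<..<1}" "g (fst z) \<in> {0<..<1}" "a (snd z) \<in> {0<..<1}" "b \<in> {0<..<1}"
      using range[OF z] g'[OF z] a'[OF z] b sub by auto
    from bregman_above_tangent[OF this]
    show "V (a (snd z)) - V b - J b * (a (snd z) - b) + ?F2 z - ?F3 z
        \<le> V (f z) - V (g (fst z)) - ?F1 z"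
      by (simp add: bregman_def)
  qed (intro int(1) I)+
  moreover have "(\<integral>z. V (f z) - V (g (fst z)) - ?F1 z \<partial>?P)
      = (\<integral>z. V (f z) \<partial>?P) - (\<integral>x. V (g x) \<partial>M1)"
    by (subst Bochner_Integration.integral_diff, (intro int(1) I)+)+ (simp only: F1 EVg diff_zero)
  moreover have "(\<integral>z. V (a (snd z)) - V b - J b * (a (snd z) - b) + ?F2 z - ?F3 z \<partial>?P)
      = (\<integral>x. V (a x) \<partial>M2) - V b"
  proof -
    have "(\<integral>z. J b * (a (snd z) - b) \<partial>?P) = 0"
      using int(1)[OF fsts(4)] by (simp add: Ea' P.prob_space)
    moreover have "(\<integral>z. V (a (snd z)) - V b \<partial>?P) = (\<integral>x. V (a x) \<partial>M2) - V b"
      using int(1)[OF fsts(5)] by (simp add: EVa P.prob_space)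
    moreover have "(\<integral>z. V (a (snd z)) - V b - J b * (a (snd z) - b) + ?F2 z - ?F3 z \<partial>?P)
      = (\<integral>z. V (a (snd z)) - V b \<partial>?P) - (\<integral>z. J b * (a (snd z) - b) \<partial>?P)
        + (\<integral>z. ?F2 z \<partial>?P) - (\<integral>z. ?F3 z \<partial>?P)"
      by (subst Bochner_Integration.integral_diff Bochner_Integration.integral_add, (intro int(1) I)+)+ (rule refl)
    ultimately show ?thesis by (simp only: F2 F3)
  qed
  ultimately show ?thesis
    by (simp add: g_def a_def b_def)
qed

text \<open>Moving values into the open unit interval keeps \<open>J\<close>, which may blow up at its end points,
  bounded.\<close>

definition contract :: "nat \<Rightarrow> real \<Rightarrow> real" where
  "contract k x = 1 / (real k + 3) + (1 - 2 / (real k + 3)) * x"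

lemma contract_in_interval:
  assumes "x \<in> {0..1}"
  shows "contract k x \<in> {1 / (real k + 3)..1 - 1 / (real k + 3)}"
proof -
  define e where "e = 1 / (real k + 3)"
  \<comment> \<open>The offset 3 keeps e at most 1/3 even for k = 0.\<close>
  have "0 \<le> 1 - 2 * e" by (simp add: e_def field_simps)
  then have "0 \<le> (1 - 2 * e) * x" "(1 - 2 * e) * x \<le> (1 - 2 * e) * 1"
    using assms by (intro mult_nonneg_nonneg mult_left_mono; simp)+
  moreover have "contract k x = e + (1 - 2 * e) * x"
    by (simp add: contract_def e_def)
  ultimately have "contract k x \<in> {e..1 - e}" by simp
  then show ?thesis by (simp add: e_def)
qed

lemma contract_in_unit:
  assumes "x \<in> {0..1}"
  shows "contract k x \<in> {0..1}"
proof -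
  have "0 \<le> 1 / (real k + 3)" by simp
  with contract_in_interval[OF assms, of k] show ?thesis
    unfolding atLeastAtMost_iff by linarith
qed

lemma contract_tendsto: "(\<lambda>k. contract k x) \<longlonglongrightarrow> x"
proof -
  have "(\<lambda>k. 1 / (real k + 3)) \<longlonglongrightarrow> 0"
    by real_asymp
  then have "(\<lambda>k. 1 / (real k + 3) + (1 - 2 * (1 / (real k + 3))) * x) \<longlonglongrightarrow> 0 + (1 - 2 * 0) * x"
    by (intro tendsto_intros)
  then show ?thesis by (simp add: contract_def)
qed

lemma V_contract_tendsto:
  assumes "x \<in> {0..1}"
  shows "(\<lambda>k. V (contract k x)) \<longlonglongrightarrow> V x"
  using assms by (intro continuous_on_tendsto_compose[OF V_cont contract_tendsto] always_eventually)
    (auto intro!: contract_in_unit simp del: atLeastAtMost_iff)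

lemma integral_V_contract_tendsto:
  assumes "prob_space M" and g: "g \<in> borel_measurable M"
    and range: "\<And>x. x \<in> space M \<Longrightarrow> g x \<in> {0..1}"
  shows "(\<lambda>k. \<integral>x. V (contract k (g x)) \<partial>M) \<longlonglongrightarrow> (\<integral>x. V (g x) \<partial>M)"
proof -
  interpret prob_space M by fact
  have "bounded (V ` {0..1})"
    using V_cont by (intro compact_imp_bounded compact_continuous_image) auto
  then obtain B where B: "\<forall>y\<in>{0..1}. \<bar>V y\<bar> \<le> B"
    by (auto simp: bounded_real)
  have meas: "(\<lambda>x. V (h x)) \<in> borel_measurable M"
    if "h \<in> borel_measurable M" "\<And>x. x \<in> space M \<Longrightarrow> h x \<in> {0..1}" for h
    using bounded_measurable_continuous_compose[OF that V_cont] by (simp add: bounded_measurable_def)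
  show ?thesis
  proof (rule integral_dominated_convergence[where w = "\<lambda>_. B"])
    show "(\<lambda>x. V (g x)) \<in> borel_measurable M"
      by (rule meas[OF g range])
    show "(\<lambda>x. V (contract k (g x))) \<in> borel_measurable M" for k
      by (rule meas[OF _ contract_in_unit[OF range]]) (use g in \<open>simp_all add: contract_def\<close>)
    show "AE x in M. (\<lambda>k. V (contract k (g x))) \<longlonglongrightarrow> V (g x)"
      by (intro AE_I2 V_contract_tendsto range)
    show "AE x in M. norm (V (contract k (g x))) \<le> B" for k
      using B contract_in_unit[OF range] by (intro AE_I2) auto
  qed simp
qed

text \<open>\<open>contract k\<close> is affine, hence commutes with all the expectations, so the
  interior case applies to the contracted function. Continuity of \<open>V\<close> on the closed
  interval and dominated convergence then give the limit in k.\<close>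

theorem entropy_two_variables:
  assumes "prob_space M1" "prob_space M2"
    and f: "f \<in> borel_measurable (M1 \<Otimes>\<^sub>M M2)"
    and range: "\<And>z. z \<in> space (M1 \<Otimes>\<^sub>M M2) \<Longrightarrow> f z \<in> {0..1}"
  shows "(\<integral>x. V (\<integral>y. f (x, y) \<partial>M2) \<partial>M1) + (\<integral>y. V (\<integral>x. f (x, y) \<partial>M1) \<partial>M2)
    \<le> V (\<integral>z. f z \<partial>(M1 \<Otimes>\<^sub>M M2)) + (\<integral>z. V (f z) \<partial>(M1 \<Otimes>\<^sub>M M2))"
proof -
  interpret M1: prob_space M1 by fact
  interpret M2: prob_space M2 by fact
  interpret P: pair_prob_space M1 M2 ..
  let ?P = "M1 \<Otimes>\<^sub>M M2"
  define g where "g x = (\<integral>y. f (x, y) \<partial>M2)" for x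
  define a where "a y = (\<integral>x. f (x, y) \<partial>M1)" for y
  define b where "b = (\<integral>z. f z \<partial>?P)"
  note f[measurable]
  have bf: "bounded_measurable ?P f"
    by (rule bounded_measurable_continuous_compose[OF f range continuous_on_id])
  have space: "(x, y) \<in> space ?P" if "x \<in> space M1" "y \<in> space M2" for x y
    using that by (simp add: space_pair_measure)
  have fx: "bounded_measurable M2 (\<lambda>y. f (x, y))" if "x \<in> space M1" for x
    by (rule bounded_measurable_compose[OF bf]) (use that in measurable)
  have fy: "bounded_measurable M1 (\<lambda>x. f (x, y))" if "y \<in> space M2" for y
    by (rule bounded_measurable_compose[OF bf]) (use that in measurable)
  have gm[measurable]: "g \<in> borel_measurable M1" and am[measurable]: "a \<in> borel_measurable M2"
    unfolding g_def a_def by measurable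
  have g: "g x \<in> {0..1}" if "x \<in> space M1" for x
    unfolding g_def using fx[OF that] range[OF space[OF that]]
    by (intro M2.expectation_in_interval) (auto simp: bounded_measurable_def)
  have a: "a y \<in> {0..1}" if "y \<in> space M2" for y
    unfolding a_def using fy[OF that] range[OF space[OF _ that]]
    by (intro M1.expectation_in_interval) (auto simp: bounded_measurable_def)
  have b: "b \<in> {0..1}"
    unfolding b_def by (rule P.expectation_in_interval[OF f range])
  have ineq: "(\<integral>x. V (contract k (g x)) \<partial>M1) + (\<integral>y. V (contract k (a y)) \<partial>M2)
    \<le> V (contract k b) + (\<integral>z. V (contract k (f z)) \<partial>?P)" for k
  proof -
    let ?l = "1 / (real k + 3)"
    have l: "0 < ?l" "1 - ?l < 1" by (auto simp: field_simps)
    have fm: "(\<lambda>z. contract k (f z)) \<in> borel_measurable ?P"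
      by (simp add: contract_def)
    have "(\<integral>y. contract k (f (x, y)) \<partial>M2) = contract k (g x)" if "x \<in> space M1" for x
      using M2.integrable_bounded_measurable[OF fx[OF that]]
      by (simp add: contract_def g_def M2.prob_space)
    moreover have "(\<integral>x. contract k (f (x, y)) \<partial>M1) = contract k (a y)" if "y \<in> space M2" for y
      using M1.integrable_bounded_measurable[OF fy[OF that]]
      by (simp add: contract_def a_def M1.prob_space)
    moreover have "(\<integral>z. contract k (f z) \<partial>?P) = contract k b"
      using P.integrable_bounded_measurable[OF bf] by (simp add: contract_def b_def P.prob_space)
    ultimately show ?thesis
      using entropy_two_variables_interior[OF assms(1,2) fm contract_in_interval[OF range] l]
      by (simp cong: Bochner_Integration.integral_cong)
  qed
  have lims: "(\<lambda>k. (\<integral>x. V (contract k (g x)) \<partial>M1) + (\<integral>y. V (contract k (a y)) \<partial>M2))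
      \<longlonglongrightarrow> (\<integral>x. V (g x) \<partial>M1) + (\<integral>y. V (a y) \<partial>M2)"
    "(\<lambda>k. V (contract k b) + (\<integral>z. V (contract k (f z)) \<partial>?P)) \<longlonglongrightarrow> V b + (\<integral>z. V (f z) \<partial>?P)"
    by (intro tendsto_add integral_V_contract_tendsto V_contract_tendsto assms gm g am a b
        P.prob_space_axioms f range; assumption)+
  show ?thesis
    using LIMSEQ_le[OF lims] ineq by (simp add: g_def a_def b_def)
qed

text \<open>By \<open>V_0\<close> and \<open>V_1\<close> an indicator satisfies V(f) = f, so the
  last term becomes the measure itself. This extra measure is what each new dimension adds to the
  factor n - 1 in the moment bound.\<close>

corollary entropy_two_variables_set:
  assumes "prob_space M1" "prob_space M2" and A[measurable]: "A \<in> sets (M1 \<Otimes>\<^sub>M M2)"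
  shows "(\<integral>x. V (measure M2 (Pair x -` A)) \<partial>M1) + (\<integral>y. V (measure M1 ((\<lambda>x. (x, y)) -` A)) \<partial>M2)
    \<le> V (measure (M1 \<Otimes>\<^sub>M M2) A) + measure (M1 \<Otimes>\<^sub>M M2) A"
proof -
  interpret M1: prob_space M1 by fact
  interpret M2: prob_space M2 by fact
  interpret P: pair_prob_space M1 M2 ..
  have x: "(\<integral>y. indicator A (x, y) \<partial>M2) = measure M2 (Pair x -` A)" for x
  proof -
    have "(\<integral>y. indicator A (x, y) \<partial>M2) = (\<integral>y. indicator (Pair x -` A) y \<partial>M2)"
      by (intro Bochner_Integration.integral_cong) (auto simp: indicator_def)
    also have "\<dots> = measure M2 (Pair x -` A \<inter> space M2)"
      by simp
    also have "Pair x -` A \<inter> space M2 = Pair x -` A"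
      using sets.sets_into_space[OF A] by (auto simp: space_pair_measure)
    finally show ?thesis .
  qed
  have y: "(\<integral>x. indicator A (x, y) \<partial>M1) = measure M1 ((\<lambda>x. (x, y)) -` A)" for y
  proof -
    have "(\<integral>x. indicator A (x, y) \<partial>M1) = (\<integral>x. indicator ((\<lambda>x. (x, y)) -` A) x \<partial>M1)"
      by (intro Bochner_Integration.integral_cong) (auto simp: indicator_def)
    also have "\<dots> = measure M1 ((\<lambda>x. (x, y)) -` A \<inter> space M1)"
      by simp
    also have "(\<lambda>x. (x, y)) -` A \<inter> space M1 = (\<lambda>x. (x, y)) -` A"
      using sets.sets_into_space[OF A] by (auto simp: space_pair_measure)
    finally show ?thesis .
  qed
  have V: "(\<lambda>z. V (indicator A z)) = indicator A"
    by (auto simp: indicator_def V_0 V_1)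
  have "A \<inter> space (M1 \<Otimes>\<^sub>M M2) = A"
    using sets.sets_into_space[OF A] by auto
  moreover have "indicator A z \<in> {0..1::real}" for z
    by (simp add: indicator_def)
  ultimately show ?thesis
    using entropy_two_variables[OF assms(1,2), of "indicator A"] A by (simp add: x y V)
qed

end

section \<open>Dilations\<close>

definition scale :: "nat \<Rightarrow> real \<Rightarrow> (nat \<Rightarrow> real) \<Rightarrow> nat \<Rightarrow> real" where
  "scale n \<rho> x = (\<lambda>i\<in>{1..n}. \<rho> * x i)"

lemma dilate_eq_image: "dilate n \<rho> L = scale n \<rho> ` L"
  by (simp add: dilate_def scale_def[abs_def])

lemma space_Rn: "space (borel_Rn n) = extensional {1..n}" "space (lborel_Rn n) = extensional {1..n}"
  by (simp_all add: borel_Rn_def lborel_Rn_def space_PiM PiE_UNIV_domain PiE_def)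

lemma sets_lborel_Rn: "sets (lborel_Rn n) = sets (borel_Rn n)"
  unfolding lborel_Rn_def borel_Rn_def by (simp cong: sets_PiM_cong)

lemma scale_in_space [simp]: "scale n \<rho> x \<in> space (borel_Rn n)"
  by (simp only: scale_def space_Rn restrict_extensional)

lemma measurable_scale: "scale n \<rho> \<in> measurable (borel_Rn n) (borel_Rn n)"
  unfolding borel_Rn_def scale_def[abs_def] by (intro measurable_restrict) measurable

lemma scale_scale: "scale n a (scale n b x) = scale n (a * b) x"
  by (auto simp: scale_def fun_eq_iff)

lemma scale_1: "x \<in> space (borel_Rn n) \<Longrightarrow> scale n 1 x = x"
  by (simp only: scale_def space_Rn mult_1 extensional_restrict)

text \<open>For positive factors the image defining \<open>dilate\<close> is a preimage under the
  inverse scaling; measurability and the ideal property of dilates are read off from that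
  form.\<close>

lemma mem_dilate_iff:
  assumes "L \<subseteq> space (borel_Rn n)" "0 < \<rho>"
  shows "x \<in> dilate n \<rho> L \<longleftrightarrow> x \<in> space (borel_Rn n) \<and> scale n (1 / \<rho>) x \<in> L"
proof
  assume "x \<in> dilate n \<rho> L"
  then obtain z where "z \<in> L" "x = scale n \<rho> z" by (auto simp: dilate_eq_image)
  moreover then have "scale n (1 / \<rho>) x = z"
    using assms scale_scale[of n "1 / \<rho>" \<rho> z] scale_1[of z n] by auto
  ultimately show "x \<in> space (borel_Rn n) \<and> scale n (1 / \<rho>) x \<in> L"
    by simp
next
  assume x: "x \<in> space (borel_Rn n) \<and> scale n (1 / \<rho>) x \<in> L"
  then have "x = scale n \<rho> (scale n (1 / \<rho>) x)"
    using assms scale_scale[of n \<rho> "1 / \<rho>" x] scale_1[of x n] by simp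
  with x show "x \<in> dilate n \<rho> L" unfolding dilate_eq_image by blast
qed

lemma dilate_subset: "dilate n \<rho> L \<subseteq> space (borel_Rn n)"
  unfolding dilate_eq_image by auto

lemma dilate_dilate: "dilate n a (dilate n b L) = dilate n (a * b) L"
  by (simp add: dilate_eq_image image_image scale_scale)

lemma sets_dilate:
  assumes "L \<in> sets (borel_Rn n)" "0 < \<rho>"
  shows "dilate n \<rho> L \<in> sets (borel_Rn n)"
proof -
  have "dilate n \<rho> L = scale n (1 / \<rho>) -` L \<inter> space (borel_Rn n)"
    using mem_dilate_iff[OF sets.sets_into_space[OF assms(1)] assms(2)] by auto
  then show ?thesis using measurable_sets[OF measurable_scale assms(1)] by simp
qed

lemma is_ideal_scale_mem:
  assumes L: "is_ideal n L" and x: "x \<in> L" and a: "\<bar>a\<bar> \<le> 1"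
  shows "scale n a x \<in> L"
proof -
  have "\<bar>a * x i\<bar> \<le> \<bar>x i\<bar>" for i
    using mult_right_mono[OF a, of "\<bar>x i\<bar>"] by (simp add: abs_mult)
  then have "scale n a x \<in> (\<Pi>\<^sub>E i\<in>{1..n}. {-\<bar>x i\<bar>..\<bar>x i\<bar>})"
    unfolding scale_def by (auto simp: abs_le_iff minus_le_iff)
  then show ?thesis using L x by (auto simp: is_ideal_def)
qed

lemma is_ideal_dilate:
  assumes L: "is_ideal n L" and \<rho>: "0 < \<rho>"
  shows "is_ideal n (dilate n \<rho> L)"
  unfolding is_ideal_def
proof (intro conjI ballI subsetI)
  have sub: "L \<subseteq> space (borel_Rn n)" using L by (simp add: is_ideal_def)
  fix x z assume x: "x \<in> dilate n \<rho> L" and z: "z \<in> (\<Pi>\<^sub>E i\<in>{1..n}. {-\<bar>x i\<bar>..\<bar>x i\<bar>})"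
  have "scale n (1 / \<rho>) x \<in> L" using x by (simp add: mem_dilate_iff[OF sub \<rho>])
  moreover have "scale n (1 / \<rho>) z \<in> (\<Pi>\<^sub>E i\<in>{1..n}. {-\<bar>scale n (1 / \<rho>) x i\<bar>..\<bar>scale n (1 / \<rho>) x i\<bar>})"
    using z \<rho> unfolding scale_def by (auto simp: PiE_iff divide_simps)
  ultimately have "scale n (1 / \<rho>) z \<in> L" using L unfolding is_ideal_def by blast
  moreover have "z \<in> space (borel_Rn n)" using z by (auto simp: space_Rn PiE_iff)
  ultimately show "z \<in> dilate n \<rho> L" by (simp add: mem_dilate_iff[OF sub \<rho>])
qed (use dilate_subset in auto)

lemma is_ideal_subset_dilate:
  assumes L: "is_ideal n L" and \<rho>: "1 \<le> \<rho>"
  shows "L \<subseteq> dilate n \<rho> L"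
proof
  have sub: "L \<subseteq> space (borel_Rn n)" using L by (simp add: is_ideal_def)
  fix x assume "x \<in> L"
  then show "x \<in> dilate n \<rho> L"
    using is_ideal_scale_mem[OF L, of x "1 / \<rho>"] sub \<rho>
    by (subst mem_dilate_iff[OF sub]) auto
qed

text \<open>It suffices to compare boxes, where \<rho> ^ n splits into one factor \<rho> per
  coordinate and each coordinate is an affine substitution on the line.\<close>

lemma lborel_Rn_scale:
  assumes \<rho>: "0 < \<rho>"
  shows "lborel_Rn n = density (distr (lborel_Rn n) (borel_Rn n) (scale n \<rho>)) (\<lambda>_. ennreal (\<rho> ^ n))"
proof -
  interpret product_sigma_finite "\<lambda>_::nat. lborel :: real measure" by unfold_locales
  let ?N = "density (distr (lborel_Rn n) (borel_Rn n) (scale n \<rho>)) (\<lambda>_. ennreal (\<rho> ^ n))"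
  have meas: "scale n \<rho> \<in> measurable (lborel_Rn n) (borel_Rn n)"
    using measurable_scale[of n \<rho>] by (simp add: sets_lborel_Rn cong: measurable_cong_sets)
  have "?N = (\<Pi>\<^sub>M i\<in>{1..n}. lborel)"
  proof (rule PiM_eqI)
    show "sets ?N = sets (\<Pi>\<^sub>M i\<in>{1..n}. (lborel :: real measure))"
      by (simp add: sets_lborel_Rn[symmetric]) (simp add: lborel_Rn_def)
  next
    fix A :: "nat \<Rightarrow> real set"
    assume "\<And>i. i \<in> {1..n} \<Longrightarrow> A i \<in> sets lborel"
    then have A: "\<And>i. i \<in> {1..n} \<Longrightarrow> A i \<in> sets borel" by simp
    let ?B = "\<lambda>i. (\<lambda>x. \<rho> * x) -` A i"
    have B: "?B i \<in> sets borel" if "i \<in> {1..n}" for i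
      using measurable_sets[of "\<lambda>x. \<rho> * x" borel borel, OF _ A[OF that]] by simp
    have box: "Pi\<^sub>E {1..n} A \<in> sets (borel_Rn n)"
      unfolding borel_Rn_def using A by (intro sets_PiM_I_finite) auto
    have one: "emeasure lborel (A i) = ennreal \<rho> * emeasure lborel (?B i)" if "i \<in> {1..n}" for i
    proof -
      have "emeasure lborel (A i) = emeasure (density (distr lborel borel (\<lambda>x. 0 + \<rho> * x)) (\<lambda>_. \<bar>\<rho>\<bar>)) (A i)"
        using lborel_real_affine[of \<rho> 0] \<rho> by simp
      also have "\<dots> = ennreal \<rho> * emeasure lborel (?B i)"
        using A[OF that] \<rho> by (simp add: emeasure_density_const emeasure_distr)
      finally show ?thesis .
    qed
    have "emeasure ?N (Pi\<^sub>E {1..n} A) 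
        = ennreal (\<rho> ^ n) * emeasure (lborel_Rn n) (scale n \<rho> -` Pi\<^sub>E {1..n} A \<inter> space (lborel_Rn n))"
      using box meas by (simp add: emeasure_density_const emeasure_distr)
    also have "scale n \<rho> -` Pi\<^sub>E {1..n} A \<inter> space (lborel_Rn n) = Pi\<^sub>E {1..n} ?B"
      unfolding space_Rn scale_def by (auto simp: PiE_iff extensional_def)
    also have "emeasure (lborel_Rn n) (Pi\<^sub>E {1..n} ?B) = (\<Prod>i\<in>{1..n}. emeasure lborel (?B i))"
      unfolding lborel_Rn_def using B by (intro emeasure_PiM) auto
    also have "ennreal (\<rho> ^ n) * \<dots> = (\<Prod>i\<in>{1..n}. ennreal \<rho> * emeasure lborel (?B i))"
      using \<rho> by (simp add: prod.distrib ennreal_power)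
    also have "\<dots> = (\<Prod>i\<in>{1..n}. emeasure lborel (A i))"
      by (intro prod.cong refl one[symmetric])
    finally show "emeasure ?N (Pi\<^sub>E {1..n} A) = (\<Prod>i\<in>{1..n}. emeasure lborel (A i))" .
  qed simp
  then show ?thesis by (simp add: lborel_Rn_def)
qed

text \<open>Substituting x = \<rho> * z brings every dilate back to the same set and the same
  measure: \<rho> ^ n is the Jacobian and the exponential is the quotient of the densities at \<rho>
  * z and z. Only the integrand still depends on \<rho>.\<close>

lemma emeasure_nu_dilate:
  assumes p: "0 < p" and \<rho>: "0 < \<rho>" and L: "L \<in> sets (borel_Rn n)"
  shows "emeasure (nu p n) (dilate n \<rho> L)
    = (\<integral>\<^sup>+x. ennreal (\<rho> ^ n * exp (- ((\<rho> powr p - 1) * (\<Sum>i=1..n. \<bar>x i\<bar> powr p)))) * indicator L x \<partial>nu p n)"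
proof -
  let ?S = "\<lambda>x. \<Sum>i=1..n. \<bar>x i\<bar> powr p"
  let ?c = "(nu_const p / 2) ^ n"
  let ?f = "\<lambda>x. ennreal (?c * exp (- ?S x))"
  have c: "0 \<le> ?c" using nu_const_pos[OF p] by simp
  have [measurable]: "(\<lambda>x. x i) \<in> borel_measurable (borel_Rn n)" if "i \<in> {1..n}" for i
    unfolding borel_Rn_def using that by measurable
  have S[measurable]: "?S \<in> borel_measurable (borel_Rn n)"
    by (intro borel_measurable_sum) measurable
  have S'[measurable]: "?S \<in> borel_measurable (lborel_Rn n)"
    using S by (simp add: sets_lborel_Rn cong: measurable_cong_sets)
  have meas[measurable]: "scale n \<rho> \<in> measurable (lborel_Rn n) (borel_Rn n)"
    using measurable_scale[of n \<rho>] by (simp add: sets_lborel_Rn cong: measurable_cong_sets)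
  have dL[measurable]: "dilate n \<rho> L \<in> sets (borel_Rn n)" by (rule sets_dilate[OF L \<rho>])
  have L'[measurable]: "L \<in> sets (lborel_Rn n)" "dilate n \<rho> L \<in> sets (lborel_Rn n)"
    using L dL by (simp_all add: sets_lborel_Rn)
  note L[measurable]
  have "emeasure (nu p n) (dilate n \<rho> L) = (\<integral>\<^sup>+x. ?f x * indicator (dilate n \<rho> L) x \<partial>lborel_Rn n)"
    unfolding nu_def by (intro emeasure_density) measurable
  also have "\<dots> = (\<integral>\<^sup>+x. ?f x * indicator (dilate n \<rho> L) x
      \<partial>density (distr (lborel_Rn n) (borel_Rn n) (scale n \<rho>)) (\<lambda>_. ennreal (\<rho> ^ n)))"
    by (subst lborel_Rn_scale[OF \<rho>]) (rule refl)
  also have "\<dots> = (\<integral>\<^sup>+x. ennreal (\<rho> ^ n)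
      * (?f (scale n \<rho> x) * indicator (dilate n \<rho> L) (scale n \<rho> x)) \<partial>lborel_Rn n)"
    by (subst nn_integral_density, measurable, subst nn_integral_distr, measurable)
  also have "\<dots> = (\<integral>\<^sup>+x. ?f x * (ennreal (\<rho> ^ n * exp (- ((\<rho> powr p - 1) * ?S x))) * indicator L x) \<partial>lborel_Rn n)"
  proof (rule nn_integral_cong)
    fix x assume x: "x \<in> space (lborel_Rn n)"
    have "x \<in> space (borel_Rn n)" using x by (simp only: space_Rn)
    then have "scale n \<rho> x \<in> dilate n \<rho> L \<longleftrightarrow> x \<in> L"
      using \<rho> scale_scale[of n "1 / \<rho>" \<rho> x] scale_1[of x n]
      by (subst mem_dilate_iff[OF sets.sets_into_space[OF L] \<rho>]) simp
    moreover have "?S (scale n \<rho> x) = \<rho> powr p * ?S x"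
      using \<rho> by (simp add: scale_def sum_distrib_left abs_mult powr_mult)
    moreover have "exp (- (\<rho> powr p * ?S x)) = exp (- ?S x) * exp (- ((\<rho> powr p - 1) * ?S x))"
      by (simp add: algebra_simps flip: exp_add)
    ultimately show "ennreal (\<rho> ^ n) * (?f (scale n \<rho> x) * indicator (dilate n \<rho> L) (scale n \<rho> x))
      = ?f x * (ennreal (\<rho> ^ n * exp (- ((\<rho> powr p - 1) * ?S x))) * indicator L x)"
      using c \<rho> by (simp add: indicator_def ac_simps flip: ennreal_mult)
  qed
  also have "\<dots> = (\<integral>\<^sup>+x. ennreal (\<rho> ^ n * exp (- ((\<rho> powr p - 1) * ?S x))) * indicator L x \<partial>nu p n)"
    unfolding nu_def by (intro nn_integral_density[symmetric]) measurable
  finally show ?thesis .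
qed

lemma dilate_strip:
  assumes n: "1 \<le> n" and t: "0 < t"
  shows "dilate n t (strip n w) = strip n (t * w)"
proof -
  have "x \<in> dilate n t (strip n w) \<longleftrightarrow> x \<in> strip n (t * w)" for x
    using n t by (subst mem_dilate_iff) (auto simp: strip_def space_Rn scale_def abs_mult field_simps)
  then show ?thesis by blast
qed

section \<open>Symmetric intervals on the line and ideals in n-space\<close>

lemma nn_integral_even:
  fixes h :: "real \<Rightarrow> real"
  assumes h: "continuous_on {0..w} h" and nonneg: "\<And>x. 0 \<le> x \<Longrightarrow> 0 \<le> h x" and w: "0 \<le> w"
  shows "(\<integral>\<^sup>+x. ennreal (h \<bar>x\<bar>) * indicator {-w..w} x \<partial>lborel) = ennreal (2 * integral {0..w} h)"
proof -
  have "(h has_integral integral {0..w} h) {0..w}"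
    by (intro integrable_integral integrable_continuous_real h)
  then have pos: "((\<lambda>x. h \<bar>x\<bar>) has_integral integral {0..w} h) {0..w}"
    by (rule has_integral_eq[rotated]) simp
  have "((\<lambda>x. h \<bar>-x\<bar>) has_integral integral {0..w} h) {-w..-0}"
    by (subst has_integral_reflect_real[where f = "\<lambda>x. h \<bar>x\<bar>"]) (rule pos)
  then have "((\<lambda>x. h \<bar>x\<bar>) has_integral integral {0..w} h + integral {0..w} h) {-w..w}"
    using pos w by (intro has_integral_combine[of "-w" 0 w]) auto
  from nn_integral_has_integral_lebesgue[OF _ this] nonneg show ?thesis
    by (simp add: mult.commute ennreal_mult' ennreal_indicator)
qed

locale weibull =
  fixes p :: real
  assumes p: "0 < p" "p \<le> 1"
begin

text \<open>On the half-line this is the density of |x| for x distributed by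
  \<open>nu_line p\<close>; the two signs cancel the 1/2 in \<open>nu_line\<close>.\<close>

definition abs_density :: "real \<Rightarrow> real" where
  "abs_density x = nu_const p * exp (- (x powr p))"

definition abs_cdf :: "real \<Rightarrow> real" where
  "abs_cdf w = integral {0..w} abs_density"

lemma abs_density_pos: "0 < abs_density x"
  using nu_const_pos[OF p(1)] by (simp add: abs_density_def)

lemma abs_density_continuous: "continuous_on A abs_density" if "A \<subseteq> {0..}"
  unfolding abs_density_def[abs_def] using that p by (auto intro!: continuous_intros continuous_on_powr')

lemma abs_density_deriv: "0 < w \<Longrightarrow> (abs_density has_real_derivative - (p * w powr (p - 1) * abs_density w)) (at w)"
  unfolding abs_density_def[abs_def] by (auto intro!: derivative_eq_intros)

lemma abs_cdf_0: "abs_cdf 0 = 0"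
  by (simp add: abs_cdf_def)

lemma abs_cdf_continuous: "continuous_on {0..} abs_cdf"
proof -
  have "continuous_on {0..b} abs_cdf" for b
    unfolding abs_cdf_def[abs_def]
    by (intro indefinite_integral_continuous_1 integrable_continuous_real abs_density_continuous) auto
  then have "continuous (at w within {0..w + 1}) abs_cdf" if "0 \<le> w" for w
    using that by (simp add: continuous_on_eq_continuous_within)
  moreover have "at w within {0..w + 1} = at w within {0..}" for w :: real
    by (rule at_within_nhd[of w "{..<w + 1}"]) auto
  ultimately show ?thesis by (simp add: continuous_on_eq_continuous_within)
qed

lemma abs_cdf_deriv:
  assumes "0 < w"
  shows "(abs_cdf has_real_derivative abs_density w) (at w)"
proof -
  have "(abs_cdf has_real_derivative abs_density w) (at w within {0..w + 1})"
    unfolding abs_cdf_def[abs_def]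
    by (intro integral_has_real_derivative abs_density_continuous) (use assms in auto)
  moreover have "at w within {0..w + 1} = at w"
    using assms by (intro at_within_interior) (simp add: interior_atLeastAtMost_real)
  ultimately show ?thesis by simp
qed

lemma abs_cdf_strict_mono:
  assumes "0 \<le> v" "v < w"
  shows "abs_cdf v < abs_cdf w"
proof (rule DERIV_pos_imp_increasing_open[OF assms(2)])
  show "\<exists>y. (abs_cdf has_real_derivative y) (at x) \<and> 0 < y" if "v < x" "x < w" for x
    using abs_cdf_deriv[of x] abs_density_pos[of x] assms that by auto
  show "continuous_on {v..w} abs_cdf"
    by (rule continuous_on_subset[OF abs_cdf_continuous]) (use assms in auto)
qed

lemma abs_cdf_mono: "0 \<le> v \<Longrightarrow> v \<le> w \<Longrightarrow> abs_cdf v \<le> abs_cdf w"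
  using abs_cdf_strict_mono[of v w] by (cases "v = w") auto

lemma abs_cdf_nonneg: "0 \<le> w \<Longrightarrow> 0 \<le> abs_cdf w"
  using abs_cdf_mono[of 0 w] by (simp add: abs_cdf_0)

lemma integral_moment:
  assumes "0 \<le> w"
  shows "integral {0..w} (\<lambda>x. p * x powr p * abs_density x) = abs_cdf w - w * abs_density w"
proof -
  have "((\<lambda>x. abs_density x - p * x powr p * abs_density x) has_integral w * abs_density w - 0 * abs_density 0) {0..w}"
  \<comment> \<open>For p < 1 \<open>abs_density\<close> has no finite one-sided derivative at 0, so
    the derivative is taken only inside the interval.\<close>
  proof (rule fundamental_theorem_of_calculus_interior[OF assms])
    show "continuous_on {0..w} (\<lambda>x. x * abs_density x)"
      by (intro continuous_intros abs_density_continuous) auto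
    show "((\<lambda>x. x * abs_density x) has_vector_derivative abs_density x - p * x powr p * abs_density x) (at x)"
      if "x \<in> {0<..<w}" for x
      unfolding has_real_derivative_iff_has_vector_derivative[symmetric]
      using that by (auto intro!: derivative_eq_intros abs_density_deriv simp: powr_diff field_simps)
  qed
  moreover have "(abs_density has_integral abs_cdf w) {0..w}"
    unfolding abs_cdf_def by (intro integrable_integral integrable_continuous_real abs_density_continuous) auto
  ultimately have "((\<lambda>x. abs_density x - (abs_density x - p * x powr p * abs_density x)) has_integral
      abs_cdf w - (w * abs_density w - 0 * abs_density 0)) {0..w}"
    by (rule has_integral_diff[rotated])
  then show ?thesis by (simp add: integral_unique)
qed

lemma abs_density_measurable [measurable]: "abs_density \<in> borel_measurable borel"
  by (simp add: abs_density_def[abs_def])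

lemma nu_line_eq: "nu_line p = density lborel (\<lambda>x. ennreal (abs_density \<bar>x\<bar> / 2))"
  by (simp add: nu_line_def abs_density_def)

lemma emeasure_nu_line_symmetric:
  assumes "0 \<le> w"
  shows "emeasure (nu_line p) {-w..w} = ennreal (abs_cdf w)"
proof -
  have "emeasure (nu_line p) {-w..w} = (\<integral>\<^sup>+x. ennreal (abs_density \<bar>x\<bar> / 2) * indicator {-w..w} x \<partial>lborel)"
    unfolding nu_line_eq by (subst emeasure_density) auto
  also have "\<dots> = ennreal (2 * integral {0..w} (\<lambda>x. abs_density x / 2))"
    using assms abs_density_pos by (intro nn_integral_even continuous_intros abs_density_continuous)
      (auto intro: less_imp_le)
  finally show ?thesis by (simp add: abs_cdf_def)
qed

lemma moment_nu_line_symmetric: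
  assumes "0 \<le> w"
  shows "(\<integral>\<^sup>+x. ennreal (p * \<bar>x\<bar> powr p) * indicator {-w..w} x \<partial>nu_line p) = ennreal (abs_cdf w - w * abs_density w)"
proof -
  have "(\<integral>\<^sup>+x. ennreal (p * \<bar>x\<bar> powr p) * indicator {-w..w} x \<partial>nu_line p)
      = (\<integral>\<^sup>+x. ennreal (abs_density \<bar>x\<bar> / 2) * (ennreal (p * \<bar>x\<bar> powr p) * indicator {-w..w} x) \<partial>lborel)"
    unfolding nu_line_eq by (subst nn_integral_density) auto
  also have "\<dots> = (\<integral>\<^sup>+x. ennreal (p * \<bar>x\<bar> powr p * abs_density \<bar>x\<bar> / 2) * indicator {-w..w} x \<partial>lborel)"
  proof (rule nn_integral_cong)
    fix x
    have "0 \<le> abs_density \<bar>x\<bar>" using abs_density_pos less_imp_le by blast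
    then show "ennreal (abs_density \<bar>x\<bar> / 2) * (ennreal (p * \<bar>x\<bar> powr p) * indicator {-w..w} x)
      = ennreal (p * \<bar>x\<bar> powr p * abs_density \<bar>x\<bar> / 2) * indicator {-w..w} x"
      using p by (simp add: indicator_def mult.commute flip: ennreal_mult)
  qed
  also have "\<dots> = ennreal (2 * integral {0..w} (\<lambda>x. p * x powr p * abs_density x / 2))"
    using assms p abs_density_pos less_imp_le[OF abs_density_pos]
    by (intro nn_integral_even continuous_intros continuous_on_powr' abs_density_continuous) auto
  also have "2 * integral {0..w} (\<lambda>x. p * x powr p * abs_density x / 2) = abs_cdf w - w * abs_density w"
    using integral_moment[OF assms] by (simp add: field_simps)
  finally show ?thesis .
qed

lemma abs_cdf_tendsto: "(\<lambda>n. abs_cdf (real n)) \<longlonglongrightarrow> 1"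
proof -
  interpret prob_space "nu_line p" by (rule prob_space_nu_line[OF p(1)])
  have "(\<lambda>n. measure (nu_line p) {- real n..real n}) \<longlonglongrightarrow> measure (nu_line p) (\<Union>n. {- real n..real n})"
    by (intro finite_Lim_measure_incseq) (auto simp: incseq_def nu_line_def)
  moreover have "(\<Union>n. {- real n..real n}) = space (nu_line p)"
  proof -
    have "\<exists>n. x \<in> {- real n..real n}" for x :: real
      using real_arch_simple[of "\<bar>x\<bar>"] by (auto simp: abs_le_iff minus_le_iff)
    then show ?thesis by (auto simp: nu_line_def)
  qed
  moreover have "measure (nu_line p) {- real n..real n} = abs_cdf (real n)" for n
    using emeasure_nu_line_symmetric[of "real n"] abs_cdf_nonneg by (simp add: measure_def)
  ultimately show ?thesis by (simp add: prob_space)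
qed

lemma abs_cdf_less_1:
  assumes "0 \<le> w"
  shows "abs_cdf w < 1"
proof -
  have "abs_cdf (w + 1) \<le> 1"
  proof (rule LIMSEQ_le_const[OF abs_cdf_tendsto])
    obtain m :: nat where "w + 1 \<le> real m"
      using real_arch_simple by blast
    then have "\<forall>n\<ge>m. abs_cdf (w + 1) \<le> abs_cdf (real n)"
      using assms by (intro allI impI abs_cdf_mono) auto
    then show "\<exists>N. \<forall>n\<ge>N. abs_cdf (w + 1) \<le> abs_cdf (real n)" ..
  qed
  then show ?thesis using abs_cdf_strict_mono[OF assms, of "w + 1"] by simp
qed

lemma abs_cdf_surj:
  assumes "0 \<le> a" "a < 1"
  obtains w where "0 \<le> w" "abs_cdf w = a"
proof -
  have "eventually (\<lambda>n. a < abs_cdf (real n)) sequentially"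
    using order_tendstoD(1)[OF abs_cdf_tendsto assms(2)] .
  then obtain n where "a < abs_cdf (real n)" by (auto simp: eventually_sequentially)
  then have "\<exists>w\<ge>0. w \<le> real n \<and> abs_cdf w = a"
    using assms by (intro IVT' continuous_on_subset[OF abs_cdf_continuous]) (auto simp: abs_cdf_0)
  then show ?thesis using that by auto
qed

section \<open>The quantile function of the absolute value\<close>

definition abs_quantile :: "real \<Rightarrow> real" where
  "abs_quantile = inv_into {0..} abs_cdf"

lemma abs_quantile_cdf: "0 \<le> w \<Longrightarrow> abs_quantile (abs_cdf w) = w"
proof -
  have "inj_on abs_cdf {0..}"
    by (rule linorder_inj_onI') (use abs_cdf_strict_mono in force)
  then show "0 \<le> w \<Longrightarrow> abs_quantile (abs_cdf w) = w" by (simp add: abs_quantile_def)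
qed

lemma
  assumes "0 \<le> a" "a < 1"
  shows abs_quantile_nonneg: "0 \<le> abs_quantile a" and abs_cdf_quantile: "abs_cdf (abs_quantile a) = a"
proof -
  obtain w where w: "0 \<le> w" "abs_cdf w = a" using abs_cdf_surj[OF assms] .
  then have "abs_quantile a = w" using abs_quantile_cdf[of w] by simp
  then show "0 \<le> abs_quantile a" "abs_cdf (abs_quantile a) = a" using w by simp_all
qed

lemma abs_cdf_less_iff: "0 \<le> v \<Longrightarrow> 0 \<le> w \<Longrightarrow> abs_cdf v < abs_cdf w \<longleftrightarrow> v < w"
  using abs_cdf_strict_mono[of v w] abs_cdf_mono[of w v] by force

lemma less_abs_quantile_iff:
  assumes "0 \<le> w" "0 \<le> a" "a < 1"
  shows "w < abs_quantile a \<longleftrightarrow> abs_cdf w < a"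
  using abs_cdf_less_iff[OF assms(1) abs_quantile_nonneg[OF assms(2,3)]] abs_cdf_quantile[OF assms(2,3)] by simp

lemma abs_quantile_mono:
  assumes "0 \<le> a" "a \<le> b" "b < 1"
  shows "abs_quantile a \<le> abs_quantile b"
  using less_abs_quantile_iff[OF abs_quantile_nonneg, of b a] abs_cdf_quantile[of b] assms by fastforce

lemma abs_quantile_pos: "0 < a \<Longrightarrow> a < 1 \<Longrightarrow> 0 < abs_quantile a"
  by (simp add: less_abs_quantile_iff abs_cdf_0)

lemma abs_quantile_deriv:
  assumes "a \<in> {0<..<1}"
  shows "(abs_quantile has_real_derivative 1 / abs_density (abs_quantile a)) (at a)"
proof -
  have abs_quantile: "0 < abs_quantile a" "abs_cdf (abs_quantile a) = a"
    using assms abs_quantile_pos abs_cdf_quantile by auto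
  have "(abs_quantile has_derivative (*) (1 / abs_density (abs_quantile a))) (at (abs_cdf (abs_quantile a)))"
  proof (rule has_derivative_inverse_strong[where S = "{0<..}" and f = abs_cdf
        and g = abs_quantile and f' = "(*) (abs_density (abs_quantile a))"])
    show "(abs_cdf has_derivative (*) (abs_density (abs_quantile a))) (at (abs_quantile a))"
      using abs_cdf_deriv[OF abs_quantile(1)] by (simp add: has_field_derivative_def)
    show "(*) (abs_density (abs_quantile a)) \<circ> (*) (1 / abs_density (abs_quantile a)) = id"
      using abs_density_pos[of "abs_quantile a"] by auto
  qed (use abs_quantile in \<open>auto intro!: continuous_on_subset[OF abs_cdf_continuous] abs_quantile_cdf\<close>)
  then show ?thesis by (simp add: abs_quantile has_field_derivative_def)
qed

section \<open>The profile and its derivatives\<close>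

definition profile :: "real \<Rightarrow> real" where \<comment> \<open>\<open>abs_quantile\<close> is arbitrary from \<open>1\<close> on\<close>
  "profile a = (if a < 1 then a - abs_quantile a * abs_density (abs_quantile a) else 1)"

lemma profile_abs_cdf: "0 \<le> w \<Longrightarrow> profile (abs_cdf w) = abs_cdf w - w * abs_density w"
  by (simp add: profile_def abs_quantile_cdf abs_cdf_less_1)

lemma profile_abs_cdf_nonneg: "0 \<le> w \<Longrightarrow> 0 \<le> profile (abs_cdf w)"
proof -
  assume w: "0 \<le> w"
  have "0 \<le> integral {0..w} (\<lambda>x. p * x powr p * abs_density x)"
    using p less_imp_le[OF abs_density_pos] by (intro Henstock_Kurzweil_Integration.integral_nonneg integrable_continuous_real
        continuous_intros continuous_on_powr' abs_density_continuous) auto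
  then show ?thesis by (simp add: profile_abs_cdf[OF w] integral_moment[OF w])
qed

lemma weight_tendsto: "((\<lambda>w. w * abs_density w) \<longlongrightarrow> 0) at_top"
proof -
  have "((\<lambda>w. nu_const p * (w * exp (- (w powr p)))) \<longlongrightarrow> nu_const p * 0) at_top"
    using p by (intro tendsto_mult tendsto_const) real_asymp
  then show ?thesis by (simp add: abs_density_def[abs_def] mult.left_commute)
qed

text \<open>As a tends to 1 the quantile w tends to infinity, where w * abs_density w vanishes. The
  end point matters because indicators take the value 1.\<close>

lemma profile_tendsto_1: "(profile \<longlongrightarrow> 1) (at_left 1)"
proof -
  have "\<forall>\<^sub>F a in at_left 1. Z \<le> abs_quantile a" for Z
  proof -
    define W where "W = max 0 Z"
    have "\<forall>\<^sub>F a in at_left 1. a \<in> {abs_cdf W<..<1}"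
      by (intro eventually_at_leftI[of "abs_cdf W"] abs_cdf_less_1) (simp_all add: W_def)
    then show ?thesis
    proof eventually_elim
      case (elim a)
      moreover have "0 \<le> abs_cdf W" by (simp add: abs_cdf_nonneg W_def)
      ultimately have "W < abs_quantile a" by (subst less_abs_quantile_iff) (auto simp: W_def)
      then show ?case by (simp add: W_def)
    qed
  qed
  then have "filterlim abs_quantile at_top (at_left 1)"
    by (simp add: filterlim_at_top)
  from filterlim_compose[OF weight_tendsto this]
  have "((\<lambda>a. a - abs_quantile a * abs_density (abs_quantile a)) \<longlongrightarrow> 1 - 0) (at_left 1)"
    by (intro tendsto_diff tendsto_ident_at)
  moreover have "\<forall>\<^sub>F a in at_left 1. a - abs_quantile a * abs_density (abs_quantile a) = profile a"
    by (intro eventually_at_leftI[of 0]) (auto simp: profile_def)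
  ultimately show ?thesis
    using Lim_transform_eventually by fastforce
qed

lemma profile_nonneg: "0 \<le> a \<Longrightarrow> 0 \<le> profile a"
  using profile_abs_cdf_nonneg[OF abs_quantile_nonneg, of a] abs_cdf_quantile[of a]
  by (cases "a < 1") (auto simp: profile_def)

lemma profile_le: "0 \<le> a \<Longrightarrow> a \<le> 1 \<Longrightarrow> profile a \<le> a"
  using abs_quantile_nonneg[of a] less_imp_le[OF abs_density_pos] by (auto simp: profile_def)

text \<open>Write w for the quantile of a and f for \<open>abs_density\<close>. Then dw/da = 1 / f
  w, so a - w * f w has derivative - w * f' w / f w, which is p * w powr p.\<close>

definition profile_slope :: "real \<Rightarrow> real" where
  "profile_slope a = p * abs_quantile a powr p"

definition inverse_curvature :: "real \<Rightarrow> real" where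
  "inverse_curvature a = abs_quantile a powr (1 - p) * abs_density (abs_quantile a) / p\<^sup>2"

text \<open>The factor dw/da = 1 / abs_density w cancels the density when
  \<open>inverse_curvature\<close> is differentiated; what remains is affine in w powr (-
  p).\<close>

definition inverse_curvature_slope :: "real \<Rightarrow> real" where
  "inverse_curvature_slope a = ((1 - p) * abs_quantile a powr (- p) - p) / p\<^sup>2"

lemma profile_deriv:
  assumes a: "a \<in> {0<..<1}"
  shows "(profile has_real_derivative profile_slope a) (at a)"
proof -
  have abs_quantile: "0 < abs_quantile a" using abs_quantile_pos a by auto
  have "((\<lambda>a. a - abs_quantile a * abs_density (abs_quantile a)) has_real_derivative profile_slope a) (at a)"
    using abs_quantile abs_density_pos[of "abs_quantile a"]
    by (auto intro!: derivative_eq_intros abs_quantile_deriv[OF a] DERIV_chain2[OF abs_density_deriv abs_quantile_deriv[OF a]]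
        simp: profile_slope_def powr_diff field_simps)
  then show ?thesis
  proof (rule has_field_derivative_transform_within_open[of _ _ _ "{0<..<1}"])
    show "x - abs_quantile x * abs_density (abs_quantile x) = profile x" if "x \<in> {0<..<1}" for x
      using that by (simp add: profile_def)
  qed (use a in auto)
qed

lemma profile_continuous: "continuous_on {0..1} profile"
  unfolding continuous_on_def
proof
  fix a :: real assume a: "a \<in> {0..1}"
  consider "a = 0" | "a \<in> {0<..<1}" | "a = 1" using a by fastforce
  then show "(profile \<longlongrightarrow> profile a) (at a within {0..1})"
  proof cases
    case 1
    have "(profile \<longlongrightarrow> 0) (at 0 within {0..1})"
    proof (rule tendsto_sandwich[where f = "\<lambda>_. 0" and h = "\<lambda>a. a"])
      show "\<forall>\<^sub>F x in at 0 within {0..1}. 0 \<le> profile x" "\<forall>\<^sub>F x in at 0 within {0..1}. profile x \<le> x"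
        by (auto simp: eventually_at_filter profile_nonneg profile_le)
    qed (auto intro: tendsto_ident_at)
    then show ?thesis using 1 profile_le[of 0] profile_nonneg[of 0] by simp
  next
    case 2
    then show ?thesis
      using DERIV_isCont[OF profile_deriv[OF 2]] by (simp add: isCont_def tendsto_within_subset[of _ _ _ UNIV])
  next
    case 3
    have "(profile \<longlongrightarrow> 1) (at 1 within {0..1})"
      by (rule tendsto_mono[OF _ profile_tendsto_1]) (simp add: at_within_Icc_at_left)
    then show ?thesis using 3 by (simp add: profile_def)
  qed
qed

lemma profile_slope_deriv:
  assumes a: "a \<in> {0<..<1}"
  shows "(profile_slope has_real_derivative 1 / inverse_curvature a) (at a)"
proof -
  have abs_quantile: "0 < abs_quantile a" using abs_quantile_pos a by auto
  have "(profile_slope has_real_derivative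
      p * (p * abs_quantile a powr (p - 1) * (1 / abs_density (abs_quantile a)))) (at a)"
    unfolding profile_slope_def[abs_def]
    by (intro DERIV_cmult DERIV_chain2[OF has_real_derivative_powr[OF abs_quantile] abs_quantile_deriv[OF a]])
  moreover have "p * (p * abs_quantile a powr (p - 1) * (1 / abs_density (abs_quantile a))) = 1 / inverse_curvature a"
    using abs_quantile abs_density_pos[of "abs_quantile a"] p
    by (simp add: inverse_curvature_def powr_diff power2_eq_square field_simps)
  ultimately show ?thesis by simp
qed

lemma inverse_curvature_deriv:
  assumes a: "a \<in> {0<..<1}"
  shows "(inverse_curvature has_real_derivative inverse_curvature_slope a) (at a)"
proof -
  have abs_quantile: "0 < abs_quantile a" using abs_quantile_pos a by auto
  let ?D = "((1 - p) * abs_quantile a powr (1 - p - 1) * (1 / abs_density (abs_quantile a)) * abs_density (abs_quantile a)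
    + - (p * abs_quantile a powr (p - 1) * abs_density (abs_quantile a)) * (1 / abs_density (abs_quantile a))
      * abs_quantile a powr (1 - p)) / p\<^sup>2"
  have "(inverse_curvature has_real_derivative ?D) (at a)"
    unfolding inverse_curvature_def[abs_def]
    by (intro DERIV_cdivide DERIV_mult DERIV_chain2[OF has_real_derivative_powr[OF abs_quantile] abs_quantile_deriv[OF a]]
        DERIV_chain2[OF abs_density_deriv[OF abs_quantile] abs_quantile_deriv[OF a]])
  moreover have "abs_quantile a powr (p - 1) * abs_quantile a powr (1 - p) = 1"
    using abs_quantile by (simp flip: powr_add)
  then have "?D = inverse_curvature_slope a"
    using abs_density_pos[of "abs_quantile a"] by (simp add: inverse_curvature_slope_def)
  ultimately show ?thesis by simp
qed

text \<open>The quantile increases, w powr (- p) decreases in w, and its coefficient 1 - p is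
  nonnegative. For p > 1 the monotonicity would be reversed.\<close>

lemma inverse_curvature_slope_antimono:
  assumes "0 < a" "a \<le> b" "b < 1"
  shows "inverse_curvature_slope b \<le> inverse_curvature_slope a"
proof -
  have "0 < abs_quantile a" "abs_quantile a \<le> abs_quantile b" using assms abs_quantile_pos abs_quantile_mono by auto
  then have "abs_quantile b powr (- p) \<le> abs_quantile a powr (- p)"
    using p by (intro powr_mono2') auto
  then show ?thesis
    unfolding inverse_curvature_slope_def using p by (intro divide_right_mono diff_right_mono mult_left_mono) auto
qed

sublocale entropy: entropy_function profile profile_slope inverse_curvature inverse_curvature_slope
proof
  show "0 < inverse_curvature a" if "a \<in> {0<..<1}" for a
    using that abs_quantile_pos[of a] abs_density_pos[of "abs_quantile a"] p
    by (simp add: inverse_curvature_def)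
  show "profile 0 = 0" using profile_le[of 0] profile_nonneg[of 0] by simp
  show "profile 1 = 1" by (simp add: profile_def)
qed (fact profile_deriv profile_slope_deriv inverse_curvature_deriv inverse_curvature_slope_antimono profile_continuous)+

section \<open>The moment of one-dimensional ideals\<close>

text \<open>The formula for intervals does not reach the whole line, as \<open>abs_cdf\<close> stays
  below 1. The moment is the limit over growing intervals, where the boundary term w * abs_density w
  vanishes.\<close>

lemma moment_nu_line_UNIV: "(\<integral>\<^sup>+x. ennreal (p * \<bar>x\<bar> powr p) \<partial>nu_line p) = 1"
proof -
  define D where "D = density (nu_line p) (\<lambda>x. ennreal (p * \<bar>x\<bar> powr p))"
  have D: "emeasure D A = (\<integral>\<^sup>+x. ennreal (p * \<bar>x\<bar> powr p) * indicator A x \<partial>nu_line p)"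
    if "A \<in> sets borel" for A
    unfolding D_def using that by (intro emeasure_density) (auto simp: nu_line_def)
  have "(\<lambda>n. emeasure D {- real n..real n}) \<longlonglongrightarrow> emeasure D (\<Union>n. {- real n..real n})"
    by (intro Lim_emeasure_incseq) (auto simp: incseq_def D_def nu_line_def)
  moreover have "(\<Union>n. {- real n..real n}) = UNIV"
  proof -
    have "\<exists>n. x \<in> {- real n..real n}" for x :: real
      using real_arch_simple[of "\<bar>x\<bar>"] by (auto simp: abs_le_iff minus_le_iff)
    then show ?thesis by auto
  qed
  moreover have "emeasure D {- real n..real n} = ennreal (abs_cdf (real n) - real n * abs_density (real n))" for n
    using D[of "{- real n..real n}"] moment_nu_line_symmetric[of "real n"] by simp
  moreover have "(\<lambda>n. ennreal (abs_cdf (real n) - real n * abs_density (real n))) \<longlonglongrightarrow> ennreal (1 - 0)"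
    by (intro tendsto_ennrealI tendsto_diff abs_cdf_tendsto
        filterlim_compose[OF weight_tendsto filterlim_real_sequentially])
  ultimately have "emeasure D UNIV = 1"
    by (intro LIMSEQ_unique) simp_all
  then show ?thesis using D[of UNIV] by simp
qed

lemma AE_nu_line_neq: "AE x in nu_line p. x \<noteq> c"
proof -
  have "AE x in lborel. 0 < ennreal (abs_density \<bar>x\<bar> / 2) \<longrightarrow> x \<noteq> c"
    using AE_lborel_singleton[of c] by eventually_elim simp
  then show ?thesis unfolding nu_line_eq by (subst AE_density) simp_all
qed

text \<open>A set with this symmetry is empty, the whole line, or an interval centred at 0 that may
  lack its end points. In the last case the supremum w of |x| is the radius, and the end points are
  null.\<close>

lemma moment_nu_line:
  assumes E: "E \<in> sets borel" and sym: "\<And>x y. x \<in> E \<Longrightarrow> \<bar>y\<bar> \<le> \<bar>x\<bar> \<Longrightarrow> y \<in> E"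
  shows "(\<integral>\<^sup>+x. ennreal (p * \<bar>x\<bar> powr p) * indicator E x \<partial>nu_line p)
    = ennreal (profile (measure (nu_line p) E))"
proof -
  interpret prob_space "nu_line p" by (rule prob_space_nu_line[OF p(1)])
  consider "E = {}" | "E \<noteq> {}" "\<not> bdd_above (abs ` E)" | "E \<noteq> {}" "bdd_above (abs ` E)" by argo
  then show ?thesis
  proof cases
    case 1
    then show ?thesis using entropy.V_0 by simp
  next
    case 2
    have "y \<in> E" for y
    proof -
      obtain x where "x \<in> E" "\<not> \<bar>x\<bar> \<le> \<bar>y\<bar>"
        using 2(2) unfolding bdd_above_def by blast
      then show ?thesis by (intro sym[of x y]) auto
    qed
    then have "E = UNIV" by blast
    moreover have "measure (nu_line p) UNIV = 1"
      using prob_space by (simp add: nu_line_def)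
    ultimately show ?thesis
      using moment_nu_line_UNIV entropy.V_1 by simp
  next
    case 3
    define w where "w = (SUP x\<in>E. \<bar>x\<bar>)"
    have upper: "\<bar>x\<bar> \<le> w" if "x \<in> E" for x
      unfolding w_def using that 3 by (intro cSUP_upper)
    have lower: "x \<in> E" if "\<bar>x\<bar> < w" for x
    proof -
      obtain x' where "x' \<in> E" "\<bar>x\<bar> < \<bar>x'\<bar>"
        using \<open>\<bar>x\<bar> < w\<close> less_cSUP_iff[OF 3, of "\<bar>x\<bar>"] unfolding w_def by auto
      then show ?thesis by (intro sym[of x' x]) auto
    qed
    obtain x0 where "x0 \<in> E" using 3(1) by blast
    then have w: "0 \<le> w" using upper[of x0] by simp
    have ae: "AE x in nu_line p. x \<in> E \<longleftrightarrow> x \<in> {-w..w}"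
      using AE_nu_line_neq[of w] AE_nu_line_neq[of "-w"]
    proof eventually_elim
      case (elim x)
      then show ?case using upper[of x] lower[of x] by (auto simp: abs_le_iff abs_less_iff)
    qed
    then have "measure (nu_line p) E = measure (nu_line p) {-w..w}"
      using E by (intro finite_measure_eq_AE) (auto simp: nu_line_def)
    also have "\<dots> = abs_cdf w"
      using emeasure_nu_line_symmetric[OF w] abs_cdf_nonneg[OF w] by (simp add: measure_def)
    finally have m: "measure (nu_line p) E = abs_cdf w" .
    have "(\<integral>\<^sup>+x. ennreal (p * \<bar>x\<bar> powr p) * indicator E x \<partial>nu_line p)
      = (\<integral>\<^sup>+x. ennreal (p * \<bar>x\<bar> powr p) * indicator {-w..w} x \<partial>nu_line p)"
      by (rule nn_integral_cong_AE) (use ae in \<open>eventually_elim, simp add: indicator_def\<close>)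
    then show ?thesis by (simp add: moment_nu_line_symmetric[OF w] m profile_abs_cdf[OF w])
  qed
qed

section \<open>The moment bound for ideals, by induction on the dimension\<close>

abbreviation nu_prod :: "'i set \<Rightarrow> ('i \<Rightarrow> real) measure" where
  "nu_prod I \<equiv> PiM I (\<lambda>_. nu_line p)"

lemma profile_measure_bounded_measurable:
  assumes "prob_space N" and "(\<lambda>x. emeasure N (B x)) \<in> borel_measurable M"
  shows "bounded_measurable M (\<lambda>x. profile (measure N (B x)))"
proof -
  interpret N: prob_space N by fact
  have "(\<lambda>x. measure N (B x)) \<in> borel_measurable M"
    using assms(2) unfolding measure_def by measurable
  then show ?thesis
    by (rule bounded_measurable_continuous_compose[OF _ _ profile_continuous]) simp
qed

lemma profile_measure_measurable:
  assumes "prob_space N" and "(\<lambda>x. emeasure N (B x)) \<in> borel_measurable M"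
  shows "(\<lambda>x. ennreal (profile (measure N (B x)))) \<in> borel_measurable M"
proof -
  have "(\<lambda>x. profile (measure N (B x))) \<in> borel_measurable M"
    using profile_measure_bounded_measurable[OF assms] by (simp add: bounded_measurable_def)
  then show ?thesis by (rule measurable_compose[OF _ measurable_ennreal])
qed

lemma integral_profile_measure:
  assumes "prob_space M" and "prob_space N" and "(\<lambda>x. emeasure N (B x)) \<in> borel_measurable M"
  shows "(\<integral>\<^sup>+x. ennreal (profile (measure N (B x))) \<partial>M) = ennreal (\<integral>x. profile (measure N (B x)) \<partial>M)"
proof (rule nn_integral_eq_integral)
  interpret M: prob_space M by fact
  show "integrable M (\<lambda>x. profile (measure N (B x)))"
    by (intro M.integrable_bounded_measurable profile_measure_bounded_measurable assms)
qed (simp add: profile_nonneg)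

text \<open>One copy of the measure stands on the left in place of a factor card I - 1 on the right.
  This avoids subtraction in \<open>ennreal\<close> and lets the induction start at the empty index
  set, where the measure is 0 or 1 and equals its profile.\<close>

theorem moment_nu_prod_le:
  assumes "finite I" and "K \<in> sets (nu_prod I)"
    and "\<And>x. x \<in> K \<Longrightarrow> (\<Pi>\<^sub>E i\<in>I. {-\<bar>x i\<bar>..\<bar>x i\<bar>}) \<subseteq> K"
  shows "(\<Sum>i\<in>I. \<integral>\<^sup>+x. ennreal (p * \<bar>x i\<bar> powr p) * indicator K x \<partial>nu_prod I) + emeasure (nu_prod I) K
    \<le> of_nat (card I) * emeasure (nu_prod I) K + ennreal (profile (measure (nu_prod I) K))"
  using assms
proof (induction I arbitrary: K rule: finite_induct)
  case empty
  have "K = {} \<or> K = {\<lambda>_. undefined}"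
    using empty by (auto simp: sets_PiM_empty)
  then show ?case
    by (auto simp: emeasure_PiM_empty measure_def entropy.V_0 entropy.V_1)
next
  case (insert i I)
  interpret N: prob_space "nu_line p" by (rule prob_space_nu_line[OF p(1)])
  interpret F: product_sigma_finite "\<lambda>_::'a. nu_line p" by unfold_locales
  interpret P: prob_space "nu_prod I" by (intro prob_space_PiM N.prob_space_axioms)
  interpret P': prob_space "nu_prod (insert i I)" by (intro prob_space_PiM N.prob_space_axioms)
  interpret PN: pair_prob_space "nu_prod I" "nu_line p" ..
  let ?P = "nu_prod I \<Otimes>\<^sub>M nu_line p" and ?mu = "nu_prod (insert i I)"
  \<comment> \<open>\<open>A\<close> is K seen in the product of the old coordinates with the new
    one. A row fixes the new coordinate and is again an ideal; a column fixes the old ones and is a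
    symmetric set on the line.\<close>
  define A where "A = (\<lambda>z. (fst z)(i := snd z)) -` K \<inter> space ?P"
  have K[measurable]: "K \<in> sets ?mu" by fact
  have ideal: "x' \<in> K" if "x \<in> K" "x' \<in> (\<Pi>\<^sub>E j\<in>insert i I. {-\<bar>x j\<bar>..\<bar>x j\<bar>})" for x x'
    using insert.prems(2) that by blast
  have upd: "(\<lambda>z. (fst z)(i := snd z)) \<in> measurable ?P ?mu"
    using measurable_add_dim[of i I "\<lambda>_. nu_line p"] by (simp add: split_beta')
  have A[measurable]: "A \<in> sets ?P"
    unfolding A_def by (rule measurable_sets[OF upd K])
  have mem_A: "(x, y) \<in> A \<longleftrightarrow> x(i := y) \<in> K" if "x \<in> space (nu_prod I)" for x y
    using that by (simp add: A_def space_pair_measure nu_line_def)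
  let ?row = "\<lambda>y. (\<lambda>x. (x, y)) -` A" and ?col = "\<lambda>x. Pair x -` A"
  have row[measurable]: "?row y \<in> sets (nu_prod I)" and col[measurable]: "?col x \<in> sets (nu_line p)" for x y
    using sets_Pair2[OF A] sets_Pair1[OF A] by auto
  have row_space: "x \<in> space (nu_prod I)" if "(x, y) \<in> A" for x y
    using that by (auto simp: A_def space_pair_measure)
  have row_ideal: "(\<Pi>\<^sub>E j\<in>I. {-\<bar>x j\<bar>..\<bar>x j\<bar>}) \<subseteq> ?row y" if "x \<in> ?row y" for x y
  proof
    fix x' assume x': "x' \<in> (\<Pi>\<^sub>E j\<in>I. {-\<bar>x j\<bar>..\<bar>x j\<bar>})"
    then have "x' \<in> space (nu_prod I)" by (auto simp: space_PiM PiE_iff nu_line_def)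
    moreover have "x(i := y) \<in> K"
      using that row_space mem_A by auto
    then have "x'(i := y) \<in> K"
      by (rule ideal) (use x' insert.hyps in \<open>auto simp: PiE_iff extensional_def\<close>)
    ultimately show "x' \<in> ?row y" by (simp add: mem_A)
  qed
  have col_sym: "y' \<in> ?col x" if "y \<in> ?col x" "\<bar>y'\<bar> \<le> \<bar>y\<bar>" for x y y'
  proof -
    have x: "x \<in> space (nu_prod I)" using that row_space by auto
    then have "x(i := y) \<in> K" using that mem_A by auto
    then have "x(i := y') \<in> K"
      by (rule ideal) (use x insert.hyps that in \<open>auto simp: PiE_iff extensional_def space_PiM abs_le_iff\<close>)
    then show ?thesis using x by (simp add: mem_A)
  qed
  have ind: "indicator K (x(i := y)) = (indicator (?row y) x :: ennreal)"
    "indicator K (x(i := y)) = (indicator (?col x) y :: ennreal)"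
    if "x \<in> space (nu_prod I)" for x y
    using mem_A[OF that] by (auto simp: indicator_def)
  have [measurable]: "(\<lambda>x. x j) \<in> borel_measurable ?mu" if "j \<in> insert i I" for j
    using measurable_component_singleton[OF that, of "\<lambda>_. nu_line p"]
    by (simp add: nu_line_def cong: measurable_cong_sets)
  have mK: "emeasure ?mu K = emeasure ?P A"
  proof -
    have "emeasure ?mu K = (\<integral>\<^sup>+x. \<integral>\<^sup>+y. indicator K (x(i := y)) \<partial>nu_line p \<partial>nu_prod I)"
      using F.product_nn_integral_insert[OF insert.hyps, of "indicator K"] by simp
    also have "\<dots> = (\<integral>\<^sup>+x. emeasure (nu_line p) (?col x) \<partial>nu_prod I)"
      by (intro nn_integral_cong) (simp add: ind(2))
    also have "\<dots> = emeasure ?P A"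
      by (rule N.emeasure_pair_measure_alt[symmetric, OF A])
    finally show ?thesis .
  qed
  have mK': "emeasure ?P A = (\<integral>\<^sup>+y. emeasure (nu_prod I) (?row y) \<partial>nu_line p)"
    by (rule PN.emeasure_pair_measure_alt2[OF A])
  have row_meas: "(\<lambda>y. emeasure (nu_prod I) (?row y)) \<in> borel_measurable (nu_line p)"
    by (rule PN.measurable_emeasure_Pair2[OF A])
  have row_V: "(\<integral>\<^sup>+y. ennreal (profile (measure (nu_prod I) (?row y))) \<partial>nu_line p)
      = ennreal (\<integral>y. profile (measure (nu_prod I) (?row y)) \<partial>nu_line p)"
    by (intro integral_profile_measure P.prob_space_axioms N.prob_space_axioms row_meas)
  \<comment> \<open>In the new direction nothing is lost: the one-dimensional formula is exact on
    every column.\<close>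
  have col_moment: "(\<integral>\<^sup>+x. ennreal (p * \<bar>x i\<bar> powr p) * indicator K x \<partial>?mu)
      = ennreal (\<integral>x. profile (measure (nu_line p) (?col x)) \<partial>nu_prod I)"
  proof -
    have "(\<integral>\<^sup>+x. ennreal (p * \<bar>x i\<bar> powr p) * indicator K x \<partial>?mu)
      = (\<integral>\<^sup>+x. \<integral>\<^sup>+y. ennreal (p * \<bar>y\<bar> powr p) * indicator K (x(i := y)) \<partial>nu_line p \<partial>nu_prod I)"
      by (subst F.product_nn_integral_insert[OF insert.hyps]) auto
    also have "\<dots> = (\<integral>\<^sup>+x. ennreal (profile (measure (nu_line p) (?col x))) \<partial>nu_prod I)"
    proof (rule nn_integral_cong)
      fix x assume x: "x \<in> space (nu_prod I)"
      show "(\<integral>\<^sup>+y. ennreal (p * \<bar>y\<bar> powr p) * indicator K (x(i := y)) \<partial>nu_line p)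
        = ennreal (profile (measure (nu_line p) (?col x)))"
        unfolding ind(2)[OF x] using col[of x] col_sym
        by (intro moment_nu_line) (auto simp: nu_line_def)
    qed
    also have "\<dots> = ennreal (\<integral>x. profile (measure (nu_line p) (?col x)) \<partial>nu_prod I)"
      by (intro integral_profile_measure P.prob_space_axioms N.prob_space_axioms
          N.measurable_emeasure_Pair A)
    finally show ?thesis .
  qed
  \<comment> \<open>In the old directions the induction hypothesis is applied to each row and
    integrated over the new coordinate.\<close>
  have row_moment: "(\<Sum>j\<in>I. \<integral>\<^sup>+x. ennreal (p * \<bar>x j\<bar> powr p) * indicator K x \<partial>?mu) + emeasure ?mu K
      \<le> of_nat (card I) * emeasure ?mu K + ennreal (\<integral>y. profile (measure (nu_prod I) (?row y)) \<partial>nu_line p)"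
  proof -
    have "(\<integral>\<^sup>+x. ennreal (p * \<bar>x j\<bar> powr p) * indicator K x \<partial>?mu)
      = (\<integral>\<^sup>+y. \<integral>\<^sup>+x. ennreal (p * \<bar>x j\<bar> powr p) * indicator (?row y) x \<partial>nu_prod I \<partial>nu_line p)"
      if j: "j \<in> I" for j
    proof -
      have "j \<noteq> i" using j insert.hyps by auto
      then have "(\<integral>\<^sup>+x. ennreal (p * \<bar>x j\<bar> powr p) * indicator K x \<partial>?mu)
        = (\<integral>\<^sup>+y. \<integral>\<^sup>+x. ennreal (p * \<bar>x j\<bar> powr p) * indicator K (x(i := y)) \<partial>nu_prod I \<partial>nu_line p)"
        using j by (subst F.product_nn_integral_insert_rev[OF insert.hyps]) auto
      then show ?thesis by (simp add: ind(1) cong: nn_integral_cong)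
    qed
    moreover have "(\<lambda>y. \<integral>\<^sup>+x. ennreal (p * \<bar>x j\<bar> powr p) * indicator (?row y) x \<partial>nu_prod I)
        \<in> borel_measurable (nu_line p)" if j: "j \<in> I" for j
    proof -
      have [measurable]: "(\<lambda>x. x j) \<in> borel_measurable (nu_prod I)"
        using measurable_component_singleton[OF j, of "\<lambda>_. nu_line p"]
        by (simp add: nu_line_def cong: measurable_cong_sets)
      have "(\<lambda>y. \<integral>\<^sup>+x. ennreal (p * \<bar>x j\<bar> powr p) * indicator A (x, y) \<partial>nu_prod I)
          \<in> borel_measurable (nu_line p)"
        by measurable
      then show ?thesis by (simp add: indicator_def)
    qed
    moreover note row_meas
    ultimately have "(\<Sum>j\<in>I. \<integral>\<^sup>+x. ennreal (p * \<bar>x j\<bar> powr p) * indicator K x \<partial>?mu) + emeasure ?mu K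
      = (\<integral>\<^sup>+y. (\<Sum>j\<in>I. \<integral>\<^sup>+x. ennreal (p * \<bar>x j\<bar> powr p) * indicator (?row y) x \<partial>nu_prod I)
          + emeasure (nu_prod I) (?row y) \<partial>nu_line p)"
      by (simp add: nn_integral_add nn_integral_sum mK mK')
    also have "\<dots> \<le> (\<integral>\<^sup>+y. of_nat (card I) * emeasure (nu_prod I) (?row y)
        + ennreal (profile (measure (nu_prod I) (?row y))) \<partial>nu_line p)"
      by (intro nn_integral_mono insert.IH row row_ideal)
    also have "\<dots> = of_nat (card I) * emeasure ?mu K + ennreal (\<integral>y. profile (measure (nu_prod I) (?row y)) \<partial>nu_line p)"
    proof -
      have "(\<lambda>y. ennreal (profile (measure (nu_prod I) (?row y)))) \<in> borel_measurable (nu_line p)"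
        by (rule profile_measure_measurable[OF P.prob_space_axioms row_meas])
      with row_meas show ?thesis
        by (simp add: nn_integral_add nn_integral_cmult mK mK' row_V)
    qed
    finally show ?thesis .
  qed
  have measure_eq: "measure ?P A = measure ?mu K"
    by (simp add: measure_def mK)
  let ?c = "\<integral>x. profile (measure (nu_line p) (?col x)) \<partial>nu_prod I"
  let ?r = "\<integral>y. profile (measure (nu_prod I) (?row y)) \<partial>nu_line p"
  \<comment> \<open>The two means of \<open>profile\<close> are traded for one profile and one
    measure; the latter raises card I to card (insert i I).\<close>
  have "(\<integral>x. profile (measure (nu_line p) (?col x)) \<partial>nu_prod I)
      + (\<integral>y. profile (measure (nu_prod I) (?row y)) \<partial>nu_line p)
      \<le> profile (measure ?P A) + measure ?P A"
    by (rule entropy.entropy_two_variables_set[OF P.prob_space_axioms N.prob_space_axioms A])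
  then have "ennreal (?c + ?r) \<le> ennreal (profile (measure ?P A) + measure ?P A)"
    by (rule ennreal_leI)
  moreover have "0 \<le> ?c" "0 \<le> ?r"
    by (auto intro!: integral_nonneg_AE profile_nonneg)
  ultimately have cr: "ennreal ?c + ennreal ?r \<le> ennreal (profile (measure ?mu K)) + emeasure ?mu K"
    using measure_eq by (simp add: ennreal_plus profile_nonneg P'.emeasure_eq_measure)
  have "(\<Sum>j\<in>insert i I. \<integral>\<^sup>+x. ennreal (p * \<bar>x j\<bar> powr p) * indicator K x \<partial>?mu) + emeasure ?mu K
    = ennreal ?c + ((\<Sum>j\<in>I. \<integral>\<^sup>+x. ennreal (p * \<bar>x j\<bar> powr p) * indicator K x \<partial>?mu) + emeasure ?mu K)"
    using insert.hyps by (simp add: col_moment add.assoc)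
  also have "\<dots> \<le> ennreal ?c + (of_nat (card I) * emeasure ?mu K + ennreal ?r)"
    by (intro add_left_mono row_moment)
  also have "\<dots> = of_nat (card I) * emeasure ?mu K + (ennreal ?c + ennreal ?r)"
    by (simp add: ac_simps)
  also have "\<dots> \<le> of_nat (card I) * emeasure ?mu K + (ennreal (profile (measure ?mu K)) + emeasure ?mu K)"
    by (intro add_left_mono cr)
  also have "\<dots> = of_nat (card (insert i I)) * emeasure ?mu K + ennreal (profile (measure ?mu K))"
    using insert.hyps by (simp add: algebra_simps)
  finally show ?case .
qed

section \<open>Growth of dilates and comparison with strips\<close>

text \<open>A lower bound for the measure of \<rho> K when the ideal K has measure a: in the
  pulled-back density exp (- u) is replaced by 1 - u, and the integral of u by its bound from
  \<open>moment_nu_prod_le\<close>. The division by p comes from the factor p in the moment.\<close>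

definition growth :: "nat \<Rightarrow> real \<Rightarrow> real \<Rightarrow> real" where
  "growth n \<rho> a = \<rho> ^ n * (a - (\<rho> powr p - 1) / p * ((real n - 1) * a + profile a))"

lemma growth_1: "growth n 1 a = a"
  by (simp add: growth_def)

text \<open>The factor \<rho> ^ n contributes n * a and the bracket takes away (n - 1) * a + profile
  a, so n cancels. At a = abs_cdf w the result is w * abs_density w, the growth rate of a
  strip.\<close>

lemma growth_deriv: "((\<lambda>\<rho>. growth n \<rho> a) has_real_derivative a - profile a) (at 1)"
proof -
  have "((\<lambda>\<rho>. growth n \<rho> a) has_real_derivative
      real n * 1 ^ (n - 1) * (a - (1 powr p - 1) / p * ((real n - 1) * a + profile a))
      + (0 - p * 1 powr (p - 1) / p * ((real n - 1) * a + profile a)) * 1 ^ n) (at 1)"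
    unfolding growth_def using p
    by (intro DERIV_mult DERIV_diff DERIV_const DERIV_cdivide DERIV_cmult_right)
       (auto intro!: derivative_eq_intros)
  then show ?thesis using p by (simp add: algebra_simps)
qed

text \<open>The curve \<open>abs_cdf (w * t powr \<theta>)\<close> grows strictly more slowly than \<open>F\<close> wherever they meet,
  which avoids differentiating \<open>F\<close>.\<close>

lemma growth_comparison_strict:
  assumes mono: "\<And>s t. 1 \<le> s \<Longrightarrow> s \<le> t \<Longrightarrow> F s \<le> F t"
    and growth: "\<And>t \<rho>. 1 \<le> t \<Longrightarrow> 1 \<le> \<rho> \<Longrightarrow> growth n \<rho> (F t) \<le> F (\<rho> * t)"
    and F1: "F 1 = abs_cdf w" and w: "0 < w" and \<theta>: "\<theta> < 1" and t0: "1 \<le> t0"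
  shows "abs_cdf (w * t0 powr \<theta>) \<le> F t0"
proof -
  define y where "y t = abs_cdf (w * t powr \<theta>)" for t
  define A where "A = {t \<in> {1..t0}. y t \<le> F t}"
  define s where "s = Sup A"
  have A1: "1 \<in> A" using t0 F1 by (simp add: A_def y_def)
  have bdd: "bdd_above A" unfolding A_def by (auto intro: bdd_aboveI[of _ t0])
  have le_s: "t \<le> s" if "t \<in> A" for t
    unfolding s_def by (rule cSup_upper[OF that bdd])
  have s1: "1 \<le> s" using le_s[OF A1] .
  have st0: "s \<le> t0" unfolding s_def by (rule cSup_least) (use A1 in \<open>auto simp: A_def\<close>)
  have y_deriv: "(y has_real_derivative abs_density (w * t powr \<theta>) * (w * (\<theta> * t powr (\<theta> - 1)))) (at t)"
    if "0 < t" for t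
    unfolding y_def[abs_def] using that w
    by (intro DERIV_chain2[OF abs_cdf_deriv] DERIV_cmult has_real_derivative_powr) auto
  have y_cont: "isCont y s" using y_deriv[of s] s1 by (intro DERIV_isCont) auto
  \<comment> \<open>\<open>F\<close> need not be continuous but can only jump upwards: points t of
    \<open>A\<close> just below s satisfy y t \<le> F t \<le> F s, and \<open>y\<close> is
    continuous at s.\<close>
  have "s \<in> A"
  proof (rule ccontr)
    assume "s \<notin> A"
    then have "F s < y s" using s1 st0 by (auto simp: A_def)
    then have "\<forall>\<^sub>F t in at s. F s < y t"
      using y_cont by (auto simp: isCont_def dest: order_tendstoD(1))
    then obtain d where d: "0 < d" "\<And>t. t \<noteq> s \<Longrightarrow> dist t s < d \<Longrightarrow> F s < y t"
      unfolding eventually_at by blast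
    have "s - d < Sup A" using d(1) by (simp add: s_def)
    then obtain t where t: "t \<in> A" "s - d < t"
      using less_cSup_iff[OF _ bdd] A1 by blast
    have "t \<noteq> s" using t(1) \<open>s \<notin> A\<close> by blast
    moreover have "dist t s < d" using t(2) le_s[OF t(1)] d(1) by (simp add: dist_real_def)
    ultimately have "F s < y t" by (rule d(2))
    also have "y t \<le> F t" using t(1) by (simp add: A_def)
    also have "F t \<le> F s" using t(1) le_s[OF t(1)] by (intro mono) (auto simp: A_def)
    finally show False by simp
  qed
  moreover have "s = t0"
  proof (rule ccontr)
    assume "s \<noteq> t0"
    then have less: "s < t0" using st0 by simp
    have no_right: False if "s < t" "t \<le> t0" "y t \<le> F t" for t
      using le_s[of t] that s1 by (auto simp: A_def)
    have "y s \<le> F s" using \<open>s \<in> A\<close> by (simp add: A_def)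
    then consider "y s < F s" | "F s = y s" by linarith
    then show False
    proof cases
      \<comment> \<open>A strict inequality persists a little to the right of s, because
        \<open>y\<close> is continuous and \<open>F\<close> does not decrease.\<close>
      case 1
      then have "\<forall>\<^sub>F t in at s. y t < F s"
        using y_cont by (auto simp: isCont_def dest: order_tendstoD(2))
      then obtain d where d: "0 < d" "\<And>t. t \<noteq> s \<Longrightarrow> dist t s < d \<Longrightarrow> y t < F s"
        unfolding eventually_at by blast
      define t where "t = min t0 (s + d / 2)"
      have t: "s < t" "t \<le> t0" "dist t s < d"
        using less d(1) by (auto simp: t_def dist_real_def min_def)
      have "y t \<le> F t" using d(2)[of t] t mono[OF s1, of t] by simp
      then show False using no_right t by blast
    next
      case 2
      define v where "v = w * s powr \<theta>"
      have v: "0 < v" using w s1 by (simp add: v_def)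
      have Fs: "F s = abs_cdf v" using 2 by (simp add: y_def v_def)
      \<comment> \<open>At a point of contact \<open>D\<close> vanishes at \<rho> = 1. The growth
        bound has slope v * abs_density v there and the curve only \<theta> times that, so
        \<open>D\<close> becomes positive and \<open>F\<close> overtakes the curve.\<close>
      define D where "D \<rho> = growth n \<rho> (F s) - y (\<rho> * s)" for \<rho>
      have growth_eq: "F s - profile (F s) = v * abs_density v" using v by (simp add: Fs profile_abs_cdf)
      have "((\<lambda>\<rho>. y (\<rho> * s)) has_real_derivative
          abs_density (w * (1 * s) powr \<theta>) * (w * (\<theta> * (1 * s) powr (\<theta> - 1))) * s) (at 1)"
        using s1 by (intro DERIV_chain2[OF y_deriv]) (auto intro!: derivative_eq_intros)
      moreover have "abs_density (w * (1 * s) powr \<theta>) * (w * (\<theta> * (1 * s) powr (\<theta> - 1))) * s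
          = \<theta> * (v * abs_density v)"
        using s1 by (simp add: v_def powr_diff)
      ultimately have "((\<lambda>\<rho>. y (\<rho> * s)) has_real_derivative \<theta> * (v * abs_density v)) (at 1)"
        by (simp only:)
      then have "(D has_real_derivative v * abs_density v - \<theta> * (v * abs_density v)) (at 1)"
        unfolding D_def[abs_def] using growth_deriv[of n "F s", unfolded growth_eq]
        by (intro DERIV_diff)
      moreover have "0 < v * abs_density v - \<theta> * (v * abs_density v)"
        using v abs_density_pos[of v] \<theta> by simp
      ultimately obtain d where d: "0 < d" "\<And>h. 0 < h \<Longrightarrow> h < d \<Longrightarrow> D 1 < D (1 + h)"
        using DERIV_pos_inc_right by blast
      define h where "h = min (d / 2) (t0 / s - 1)"
      have h: "0 < h" "h < d" "1 + h \<le> t0 / s"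
        using d(1) less s1 by (auto simp: h_def min_def field_simps)
      have "0 < D (1 + h)" using d(2)[OF h(1,2)] by (simp add: D_def growth_1 2)
      then have "y ((1 + h) * s) \<le> F ((1 + h) * s)"
        using growth[OF s1, of "1 + h"] h(1) by (simp add: D_def)
      moreover have "s < (1 + h) * s" "(1 + h) * s \<le> t0"
        using h s1 by (auto simp: field_simps)
      ultimately show False using no_right by blast
    qed
  qed
  ultimately show ?thesis by (simp add: A_def y_def)
qed

text \<open>Let \<theta> tend to 1 from the left in the strict comparison: the bound F t does not
  involve \<theta>, and \<open>abs_cdf\<close> is continuous at w * t.\<close>

lemma growth_comparison:
  assumes mono: "\<And>s t. 1 \<le> s \<Longrightarrow> s \<le> t \<Longrightarrow> F s \<le> F t"
    and growth: "\<And>t \<rho>. 1 \<le> t \<Longrightarrow> 1 \<le> \<rho> \<Longrightarrow> growth n \<rho> (F t) \<le> F (\<rho> * t)"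
    and F1: "F 1 = abs_cdf w" and w: "0 < w" and t: "1 \<le> t"
  shows "abs_cdf (w * t) \<le> F t"
proof (rule tendsto_upperbound)
  have "isCont abs_cdf (w * t powr 1)"
    using abs_cdf_deriv[of "w * t powr 1"] w t by (intro DERIV_isCont) auto
  then show "((\<lambda>\<theta>. abs_cdf (w * t powr \<theta>)) \<longlongrightarrow> abs_cdf (w * t)) (at_left 1)"
    using t by (intro isCont_tendsto_compose[of _ abs_cdf]) (auto intro!: tendsto_eq_intros)
  show "\<forall>\<^sub>F \<theta> in at_left 1. abs_cdf (w * t powr \<theta>) \<le> F t"
    using growth_comparison_strict[OF mono growth F1 w _ t]
    by (intro eventually_at_leftI[of 0]) auto
qed simp

section \<open>The S-inequality for ideals\<close>

lemma nu_eq_nu_prod: "nu p n = nu_prod {1..n}"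
  by (rule nu_eq_product[OF p(1)])

lemma emeasure_strip:
  assumes n: "1 \<le> n" and w: "0 \<le> w"
  shows "emeasure (nu p n) (strip n w) = ennreal (abs_cdf w)"
proof -
  interpret N: prob_space "nu_line p" by (rule prob_space_nu_line[OF p(1)])
  interpret product_sigma_finite "\<lambda>_::nat. nu_line p" by unfold_locales
  have "strip n w = (\<Pi>\<^sub>E i\<in>{1..n}. if i = 1 then {-w..w} else UNIV)"
    using n by (auto simp: strip_def space_Rn PiE_iff extensional_def abs_le_iff split: if_splits)
  then have "emeasure (nu p n) (strip n w)
      = (\<Prod>i\<in>{1..n}. emeasure (nu_line p) (if i = 1 then {-w..w} else UNIV))"
    unfolding nu_eq_nu_prod by (simp only:) (intro emeasure_PiM; auto simp: nu_line_def)
  also have "\<dots> = (\<Prod>i\<in>{1..n}. if i = 1 then ennreal (abs_cdf w) else 1)"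
  proof (intro prod.cong refl)
    have "emeasure (nu_line p) UNIV = 1"
      using N.emeasure_space_1 by (simp add: nu_line_def)
    then show "emeasure (nu_line p) (if i = 1 then {-w..w} else UNIV)
        = (if i = 1 then ennreal (abs_cdf w) else 1)" for i :: nat
      by (simp add: emeasure_nu_line_symmetric[OF w])
  qed
  also have "\<dots> = ennreal (abs_cdf w)"
    using n by (simp add: prod.delta)
  finally show ?thesis .
qed

text \<open>Integrate exp (- u) \<ge> 1 - u over L, with u equal to \<rho> powr p - 1 times the sum
  of the |x i| powr p, and bound the integral of u by \<open>moment_nu_prod_le\<close>. Only the
  value and slope of this bound at \<rho> = 1 are used in the comparison.\<close>

lemma measure_dilate_ge_growth:
  assumes n: "1 \<le> n" and L: "L \<in> sets (borel_Rn n)" and ideal: "is_ideal n L" and \<rho>: "1 \<le> \<rho>"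
  shows "growth n \<rho> (measure (nu p n) L) \<le> measure (nu p n) (dilate n \<rho> L)"
proof -
  interpret P: prob_space "nu p n" by (rule prob_space_nu[OF p(1)])
  let ?S = "\<lambda>x. \<Sum>i=1..n. \<bar>x i\<bar> powr p"
  let ?F = "measure (nu p n) L" and ?F' = "measure (nu p n) (dilate n \<rho> L)"
  let ?k = "\<rho> ^ n * ((\<rho> powr p - 1) / p)"
  have L'[measurable]: "L \<in> sets (nu p n)" using L by (simp add: sets_nu)
  have comp[measurable]: "(\<lambda>x. x i) \<in> borel_measurable (nu p n)" if "i \<in> {1..n}" for i
    using measurable_component_singleton[OF that, of "\<lambda>_. borel"]
    by (simp add: sets_nu borel_Rn_def cong: measurable_cong_sets)
  have S[measurable]: "?S \<in> borel_measurable (nu p n)"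
    by (intro borel_measurable_sum) measurable
  have \<rho>p: "1 \<le> \<rho> powr p" using \<rho> p by (simp add: ge_one_powr_ge_zero)
  have W: "0 \<le> (real n - 1) * ?F + profile ?F"
    using n by (simp add: profile_nonneg)
  have k: "0 \<le> ?k" using \<rho> \<rho>p p by simp
  \<comment> \<open>The added copy of the measure is finite and is cancelled at the end of the
    chain.\<close>
  have "(\<integral>\<^sup>+x. ennreal (p * ?S x) * indicator L x \<partial>nu p n) + emeasure (nu p n) L
      = (\<Sum>i\<in>{1..n}. \<integral>\<^sup>+x. ennreal (p * \<bar>x i\<bar> powr p) * indicator L x \<partial>nu p n) + emeasure (nu p n) L"
  proof -
    have "ennreal (p * ?S x) * indicator L x = (\<Sum>i\<in>{1..n}. ennreal (p * \<bar>x i\<bar> powr p) * indicator L x)" for x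
      using p by (simp add: sum_distrib_left flip: sum_distrib_right)
    then show ?thesis by (simp only:) (subst nn_integral_sum; measurable)
  qed
  also have "\<dots> \<le> of_nat n * emeasure (nu p n) L + ennreal (profile ?F)"
    using moment_nu_prod_le[of "{1..n}" L] L' ideal
    by (simp add: nu_eq_nu_prod is_ideal_def)
  also have "\<dots> = ennreal (((real n - 1) * ?F + profile ?F) + ?F)"
    by (simp add: P.emeasure_eq_measure profile_nonneg ennreal_of_nat_eq_real_of_nat algebra_simps
        flip: ennreal_mult ennreal_plus)
  also have "\<dots> = ennreal ((real n - 1) * ?F + profile ?F) + emeasure (nu p n) L"
    using n by (subst ennreal_plus) (auto simp: profile_nonneg P.emeasure_eq_measure)
  finally have moment: "(\<integral>\<^sup>+x. ennreal (p * ?S x) * indicator L x \<partial>nu p n) \<le> ennreal ((real n - 1) * ?F + profile ?F)"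
    by (simp add: P.emeasure_eq_measure)
  have "ennreal (\<rho> ^ n * ?F) = (\<integral>\<^sup>+x. ennreal (\<rho> ^ n) * indicator L x \<partial>nu p n)"
    using \<rho> by (simp add: nn_integral_cmult P.emeasure_eq_measure ennreal_mult)
  also have "\<dots> \<le> (\<integral>\<^sup>+x. ennreal (\<rho> ^ n * exp (- ((\<rho> powr p - 1) * ?S x))) * indicator L x
      + ennreal ?k * (ennreal (p * ?S x) * indicator L x) \<partial>nu p n)"
  proof (rule nn_integral_mono)
    fix x
    have S0: "0 \<le> ?S x" by (intro sum_nonneg) simp
    \<comment> \<open>As 1 - u may be negative, u is moved to the other side, where all terms are
      nonnegative and pass to \<open>ennreal\<close>.\<close>
    have "1 \<le> exp (- ((\<rho> powr p - 1) * ?S x)) + (\<rho> powr p - 1) * ?S x"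
      using exp_ge_add_one_self[of "- ((\<rho> powr p - 1) * ?S x)"] by simp
    then have "\<rho> ^ n * 1 \<le> \<rho> ^ n * (exp (- ((\<rho> powr p - 1) * ?S x)) + (\<rho> powr p - 1) * ?S x)"
      using \<rho> by (intro mult_left_mono) auto
    also have "\<dots> = \<rho> ^ n * exp (- ((\<rho> powr p - 1) * ?S x)) + ?k * (p * ?S x)"
      using p by (simp add: field_simps)
    finally have "ennreal (\<rho> ^ n) \<le> ennreal (\<rho> ^ n * exp (- ((\<rho> powr p - 1) * ?S x)) + ?k * (p * ?S x))"
      by (intro ennreal_leI) simp
    also have "\<dots> = ennreal (\<rho> ^ n * exp (- ((\<rho> powr p - 1) * ?S x))) + ennreal ?k * ennreal (p * ?S x)"
    proof -
      have "0 \<le> p * ?S x" "0 \<le> \<rho> ^ n * exp (- ((\<rho> powr p - 1) * ?S x))"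
        using p S0 \<rho> by auto
      then show ?thesis
        using k by (simp only: ennreal_plus ennreal_mult mult_nonneg_nonneg)
    qed
    finally show "ennreal (\<rho> ^ n) * indicator L x
      \<le> ennreal (\<rho> ^ n * exp (- ((\<rho> powr p - 1) * ?S x))) * indicator L x
        + ennreal ?k * (ennreal (p * ?S x) * indicator L x)"
      by (simp split: split_indicator)
  qed
  also have "\<dots> = ennreal ?F' + ennreal ?k * (\<integral>\<^sup>+x. ennreal (p * ?S x) * indicator L x \<partial>nu p n)"
    using emeasure_nu_dilate[OF p(1) _ L, of \<rho>] \<rho>
    by (subst nn_integral_add, measurable, subst nn_integral_cmult, measurable)
       (simp add: P.emeasure_eq_measure)
  also have "\<dots> \<le> ennreal ?F' + ennreal ?k * ennreal ((real n - 1) * ?F + profile ?F)"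
    by (intro add_left_mono mult_left_mono moment) simp
  also have "\<dots> = ennreal (?F' + ?k * ((real n - 1) * ?F + profile ?F))"
    using k W by (simp only: ennreal_plus ennreal_mult mult_nonneg_nonneg measure_nonneg)
  finally have "\<rho> ^ n * ?F \<le> ?F' + ?k * ((real n - 1) * ?F + profile ?F)"
    using k W by (simp only: ennreal_le_iff add_nonneg_nonneg mult_nonneg_nonneg measure_nonneg)
  then show ?thesis by (simp add: growth_def algebra_simps)
qed

lemma supports_S_inequality_nu:
  assumes n: "1 \<le> n" and L: "L \<in> sets (borel_Rn n)" and ideal: "is_ideal n L"
  shows "supports_S_inequality n (nu p n) L"
  unfolding supports_S_inequality_def
proof (intro allI impI)
  fix s w t :: real
  assume s: "0 < s" and w: "0 \<le> w" and t: "1 \<le> t"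
    and eq: "emeasure (nu p n) (dilate n s L) = emeasure (nu p n) (strip n w)"
  interpret P: prob_space "nu p n" by (rule prob_space_nu[OF p(1)])
  define K where "K = dilate n s L"
  define F where "F \<tau> = measure (nu p n) (dilate n \<tau> K)" for \<tau>
  have K: "K \<in> sets (borel_Rn n)" "is_ideal n K"
    unfolding K_def using sets_dilate[OF L s] is_ideal_dilate[OF ideal s] by auto
  have dK: "dilate n \<tau> K \<in> sets (borel_Rn n)" "is_ideal n (dilate n \<tau> K)" if "1 \<le> \<tau>" for \<tau>
    using that sets_dilate[OF K(1), of \<tau>] is_ideal_dilate[OF K(2), of \<tau>] by auto
  have strip_t: "emeasure (nu p n) (dilate n t (strip n w)) = ennreal (abs_cdf (w * t))"
    using n w t by (simp add: dilate_strip emeasure_strip mult.commute)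
  have "dilate n 1 K = K"
    using K(1)[THEN sets.sets_into_space] scale_1 by (force simp: dilate_eq_image image_iff)
  then have F1: "F 1 = abs_cdf w"
    using eq emeasure_strip[OF n w] abs_cdf_nonneg[OF w] by (simp add: F_def K_def measure_def)
  have mono: "F \<sigma> \<le> F \<tau>" if "1 \<le> \<sigma>" "\<sigma> \<le> \<tau>" for \<sigma> \<tau>
  proof -
    have "dilate n \<sigma> K \<subseteq> dilate n (\<tau> / \<sigma>) (dilate n \<sigma> K)"
      by (intro is_ideal_subset_dilate dK) (use that in auto)
    also have "\<dots> = dilate n \<tau> K" using that by (simp add: dilate_dilate)
    finally show ?thesis
      unfolding F_def using dK[of \<tau>] that by (intro P.finite_measure_mono) (auto simp: sets_nu)
  qed
  \<comment> \<open>Each dilate of K is itself an ideal, so the growth bound can be restarted from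
    every time \<tau>.\<close>
  have growth: "growth n \<rho> (F \<tau>) \<le> F (\<rho> * \<tau>)" if "1 \<le> \<tau>" "1 \<le> \<rho>" for \<tau> \<rho>
    using measure_dilate_ge_growth[OF n dK[OF that(1)] that(2)] by (simp add: F_def dilate_dilate)
  have "abs_cdf (w * t) \<le> F t"
  \<comment> \<open>For w = 0 the strip and its dilates are null; the comparison needs w > 0 for the
    curve to have positive slope.\<close>
  proof (cases "w = 0")
    case True
    then show ?thesis by (simp add: abs_cdf_0 F_def)
  next
    case False
    then show ?thesis using growth_comparison[OF mono growth F1 _ t] w by simp
  qed
  then show "emeasure (nu p n) (dilate n t (strip n w)) \<le> emeasure (nu p n) (dilate n t (dilate n s L))"
    unfolding strip_t by (simp add: F_def K_def P.emeasure_eq_measure ennreal_leI)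
qed

end

theorem theorem1:
  fixes p :: real and n :: nat
  assumes "0 < p" "p \<le> 1" and "n \<ge> 1"
  shows "\<forall>L \<in> sets (borel_Rn n). is_ideal n L \<longrightarrow> supports_S_inequality n (nu p n) L"
proof -
  interpret weibull p using assms by unfold_locales
  show ?thesis using supports_S_inequality_nu[OF assms(3)] by blast
qed

end
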